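(* Let $X$ be a complex Banach space, let $A\in B(X)$, and assume that $\Delta_A$ has the single-valued extension property. Let $0\le\alpha<1$. If $T\in B(X)$ satisfies, for some constant $C_T>0$, $$\|e^{tA}Te^{-tA}\|\le C_T\left(1+|t|^{\alpha}\right)\quad\text{for all } t\in\mathbb{R},$$ then $$\|AT-TA\|\le C_T\left[r_{\Delta_A}(T)+C(\alpha)\,r_{\Delta_A}(T)^{1-\alpha}\right],$$ where $$C(\alpha)=\left(\frac{2}{\pi}\right)^{2-\alpha}\sum_{k\in\mathbb{Z}}\frac{1}{|2k+1|^{2-\alpha}}.$$
   Context: $B(X)$ is the Banach algebra of all bounded linear operators on $X$, and $\Delta_A:B(X)\to B(X)$ is the bounded operator $\Delta_A(T)=AT-TA$ on the Banach space $B(X)$. A bounded operator $S$ on a complex Banach space $Y$ has the single-valued extension property (SVEP) if for every open $U\subset\mathbb{C}$ the only analytic function $u:U\to Y$ with $(zI-S)u(z)=0$ on $U$ is $u\equiv 0$. For $y\in Y$, $\rho_S(y)$ is the set of $\lambda\in\mathbb{C}$ for which there exist a neighborhood $U_\lambda$ of $\lambda$ and an analytic function $u:U_\lambda\to Y$ with $(zI-S)u(z)=y$ for all $z\in U_\lambda$; the local spectrum is $\sigma_S(y)=\mathbb{C}\setminus\rho_S(y)$, and the local spectral radius is $r_S(y)=\sup\{|\lambda|:\lambda\in\sigma_S(y)\}$ (with the convention that the supremum of the empty set is $0$). The quantity $r_{\Delta_A}(T)$ is the local spectral radius of $S=\Delta_A$ at $y=T$ in $Y=B(X)$. *)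

theory Defs
  imports "HOL-Analysis.Analysis"
begin

section \<open>Complex Banach spaces\<close>

text \<open>The real scalar multiplication of the class \<^class>\<open>banach\<close> is the restriction of the
  complex one; the trivial space is allowed.\<close>

class complex_banach = banach +
  fixes scaleC :: "complex \<Rightarrow> 'a \<Rightarrow> 'a" (infixr "*\<^sub>C" 75)
  assumes scaleC_add_right: "a *\<^sub>C (x + y) = a *\<^sub>C x + a *\<^sub>C y"
    and scaleC_add_left: "(a + b) *\<^sub>C x = a *\<^sub>C x + b *\<^sub>C x"
    and scaleC_scaleC: "a *\<^sub>C b *\<^sub>C x = (a * b) *\<^sub>C x"
    and scaleC_of_real: "complex_of_real r *\<^sub>C x = r *\<^sub>R x"
    and norm_scaleC: "norm (a *\<^sub>C x) = cmod a * norm x"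

lemma scaleC_one [simp]: "1 *\<^sub>C x = (x :: 'a::complex_banach)"
  using scaleC_of_real[of 1 x] by simp

lemma scaleC_zero_right [simp]: "a *\<^sub>C (0 :: 'a::complex_banach) = 0"
  using scaleC_add_right[of a 0 0] by simp

lemma scaleC_minus_right: "a *\<^sub>C (- x) = - (a *\<^sub>C (x :: 'a::complex_banach))"
  using scaleC_add_right[of a x "- x"] by (simp add: eq_neg_iff_add_eq_0 add.commute)

lemma scaleC_diff_right: "a *\<^sub>C (x - y) = a *\<^sub>C x - a *\<^sub>C (y :: 'a::complex_banach)"
  using scaleC_add_right[of a x "- y"] by (simp add: scaleC_minus_right)

lemma scaleC_scaleR: "a *\<^sub>C (r *\<^sub>R x) = r *\<^sub>R a *\<^sub>C (x :: 'a::complex_banach)"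
  by (metis scaleC_of_real scaleC_scaleC mult.commute)

lemma bounded_linear_scaleC: "bounded_linear (\<lambda>x :: 'a::complex_banach. a *\<^sub>C x)"
  by (rule bounded_linear_intro[where K = "cmod a"])
    (simp_all add: scaleC_add_right scaleC_scaleR norm_scaleC mult.commute)


section \<open>The Banach algebra of bounded operators\<close>

text \<open>The complex-linear operators among the bounded real-linear ones, with the operator norm.
  The type forms an instance of \<^class>\<open>monoid_mult\<close> but not of \<^class>\<open>ring_1\<close>, since \<open>1 = 0\<close>
  for the trivial space.\<close>

typedef (overloaded) 'a bounded_op =
  "{F :: 'a::complex_banach \<Rightarrow>\<^sub>L 'a. \<forall>c x. blinfun_apply F (c *\<^sub>C x) = c *\<^sub>C blinfun_apply F x}"
  morphisms blinfun_of_op op_of_blinfun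
  by (rule exI[of _ 0]) simp

setup_lifting type_definition_bounded_op

lift_definition op_apply :: "'a::complex_banach bounded_op \<Rightarrow> 'a \<Rightarrow> 'a" is blinfun_apply .

lemma op_eqI: "(\<And>x. op_apply S x = op_apply T x) \<Longrightarrow> S = T"
  by transfer (rule blinfun_eqI)

lemma op_apply_cscale: "op_apply S (c *\<^sub>C x) = c *\<^sub>C op_apply S x"
  by transfer simp

lemma bounded_linear_op_apply: "bounded_linear (op_apply S)"
  by transfer (rule blinfun.bounded_linear_right)

text \<open>Only meaningful for bounded complex-linear \<open>f\<close>.\<close>

definition bounded_op_of :: "('a::complex_banach \<Rightarrow> 'a) \<Rightarrow> 'a bounded_op"
  where "bounded_op_of f = op_of_blinfun (Blinfun f)"

lemma op_apply_bounded_op_of: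
  assumes "bounded_linear f" and "\<And>c x. f (c *\<^sub>C x) = c *\<^sub>C f x"
  shows "op_apply (bounded_op_of f) = f"
  using assms
  by (simp add: op_apply_def bounded_op_of_def op_of_blinfun_inverse bounded_linear_Blinfun_apply)

instantiation bounded_op :: (complex_banach) real_normed_vector
begin

lift_definition norm_bounded_op :: "'a bounded_op \<Rightarrow> real" is norm .

lift_definition zero_bounded_op :: "'a bounded_op" is 0
  by simp

lift_definition plus_bounded_op :: "'a bounded_op \<Rightarrow> 'a bounded_op \<Rightarrow> 'a bounded_op" is "(+)"
  by (simp add: blinfun.add_left scaleC_add_right)

lift_definition minus_bounded_op :: "'a bounded_op \<Rightarrow> 'a bounded_op \<Rightarrow> 'a bounded_op" is "(-)"
  by (simp add: blinfun.diff_left scaleC_diff_right)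

lift_definition uminus_bounded_op :: "'a bounded_op \<Rightarrow> 'a bounded_op" is uminus
  by (simp add: blinfun.minus_left scaleC_minus_right)

lift_definition scaleR_bounded_op :: "real \<Rightarrow> 'a bounded_op \<Rightarrow> 'a bounded_op" is "(*\<^sub>R)"
  by (simp add: blinfun.scaleR_left scaleC_scaleR)

definition dist_bounded_op :: "'a bounded_op \<Rightarrow> 'a bounded_op \<Rightarrow> real"
  where "dist_bounded_op S T = norm (S - T)"

definition uniformity_bounded_op :: "('a bounded_op \<times> 'a bounded_op) filter"
  where "uniformity_bounded_op = (INF e\<in>{0 <..}. principal {(S, T). dist S T < e})"

definition open_bounded_op :: "'a bounded_op set \<Rightarrow> bool"
  where "open_bounded_op U = (\<forall>S\<in>U. \<forall>\<^sub>F (S', T) in uniformity. S' = S \<longrightarrow> T \<in> U)"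

definition sgn_bounded_op :: "'a bounded_op \<Rightarrow> 'a bounded_op"
  where "sgn_bounded_op S = inverse (norm S) *\<^sub>R S"

instance
proof
  fix S T :: "'a bounded_op" and r :: real
  show "norm (S + T) \<le> norm S + norm T" by transfer (rule norm_triangle_ineq)
  show "norm (r *\<^sub>R S) = \<bar>r\<bar> * norm S" by transfer simp
qed (unfold dist_bounded_op_def uniformity_bounded_op_def open_bounded_op_def sgn_bounded_op_def,
    (rule refl | (transfer, simp add: algebra_simps))+)

end

lemma norm_op_apply: "norm (op_apply S x) \<le> norm S * norm x"
  by transfer (rule norm_blinfun)

lemma op_apply_add: "op_apply (S + T) x = op_apply S x + op_apply T x"
  by transfer (simp add: blinfun.add_left)

lemma op_apply_scaleR: "op_apply (r *\<^sub>R S) x = r *\<^sub>R op_apply S x"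
  by transfer (simp add: blinfun.scaleR_left)

lemma norm_op_bound: "0 \<le> b \<Longrightarrow> (\<And>x. norm (op_apply S x) \<le> b * norm x) \<Longrightarrow> norm S \<le> b"
  by transfer (rule norm_blinfun_bound)

instance bounded_op :: (complex_banach) banach
proof
  fix F :: "nat \<Rightarrow> 'a bounded_op"
  assume "Cauchy F"
  have norm_eq: "norm (blinfun_of_op S - blinfun_of_op T) = norm (S - T)" for S T :: "'a bounded_op"
    by transfer simp
  have "Cauchy (\<lambda>n. blinfun_of_op (F n))"
    using \<open>Cauchy F\<close> by (simp add: Cauchy_def dist_norm norm_eq)
  then obtain G where G: "(\<lambda>n. blinfun_of_op (F n)) \<longlonglongrightarrow> G"
    by (auto simp: Cauchy_convergent_iff convergent_def)
  have lim: "(\<lambda>n. blinfun_apply (blinfun_of_op (F n)) x) \<longlonglongrightarrow> blinfun_apply G x" for x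
    by (rule blinfun.tendsto[OF G tendsto_const])
  have "blinfun_apply G (c *\<^sub>C x) = c *\<^sub>C blinfun_apply G x" for c x
  proof (rule LIMSEQ_unique[OF lim])
    have "blinfun_apply (blinfun_of_op (F n)) (c *\<^sub>C x) =
        c *\<^sub>C blinfun_apply (blinfun_of_op (F n)) x" for n
      using blinfun_of_op[of "F n"] by simp
    then show "(\<lambda>n. blinfun_apply (blinfun_of_op (F n)) (c *\<^sub>C x)) \<longlonglongrightarrow> c *\<^sub>C blinfun_apply G x"
      using bounded_linear.tendsto[OF bounded_linear_scaleC lim] by simp
  qed
  then have "blinfun_of_op (op_of_blinfun G) = G"
    by (simp add: op_of_blinfun_inverse)
  with G have "F \<longlonglongrightarrow> op_of_blinfun G"
    by (simp add: LIMSEQ_iff flip: norm_eq)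
  then show "convergent F"
    by (rule convergentI)
qed

instantiation bounded_op :: (complex_banach) complex_banach
begin

definition scaleC_bounded_op :: "complex \<Rightarrow> 'a bounded_op \<Rightarrow> 'a bounded_op"
  where "scaleC_bounded_op c S = bounded_op_of (\<lambda>x. c *\<^sub>C op_apply S x)"

lemma op_apply_scaleC: "op_apply (c *\<^sub>C S) x = c *\<^sub>C op_apply S x"
  by (simp add: scaleC_bounded_op_def op_apply_bounded_op_of scaleC_scaleC op_apply_cscale
      bounded_linear_compose[OF bounded_linear_scaleC bounded_linear_op_apply] mult.commute)

instance
proof
  fix S T :: "'a bounded_op" and a b :: complex and r :: real
  show "a *\<^sub>C (S + T) = a *\<^sub>C S + a *\<^sub>C T"
    by (rule op_eqI) (simp add: op_apply_scaleC op_apply_add scaleC_add_right)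
  show "(a + b) *\<^sub>C S = a *\<^sub>C S + b *\<^sub>C S"
    by (rule op_eqI) (simp add: op_apply_scaleC op_apply_add scaleC_add_left)
  show "a *\<^sub>C b *\<^sub>C S = (a * b) *\<^sub>C S"
    by (rule op_eqI) (simp add: op_apply_scaleC scaleC_scaleC)
  show "complex_of_real r *\<^sub>C S = r *\<^sub>R S"
    by (rule op_eqI) (simp add: op_apply_scaleC op_apply_scaleR scaleC_of_real)
  have le: "norm (c *\<^sub>C R) \<le> cmod c * norm R" for c and R :: "'a bounded_op"
    by (rule norm_op_bound)
      (simp_all add: op_apply_scaleC norm_scaleC norm_op_apply mult.assoc mult_left_mono)
  show "norm (a *\<^sub>C S) = cmod a * norm S"
  proof (cases "a = 0")
    case True
    then show ?thesis using le[of a S] by simp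
  next
    case False
    have "inverse a *\<^sub>C a *\<^sub>C S = S"
      by (rule op_eqI) (simp add: op_apply_scaleC scaleC_scaleC False)
    then have "norm S \<le> norm (a *\<^sub>C S) / cmod a"
      using le[of "inverse a" "a *\<^sub>C S"] by (simp add: norm_inverse divide_inverse mult.commute)
    then have "cmod a * norm S \<le> norm (a *\<^sub>C S)"
      using False by (simp add: field_simps)
    then show ?thesis using le[of a S] by simp
  qed
qed

end

instantiation bounded_op :: (complex_banach) "{real_normed_algebra, monoid_mult}"
begin

lift_definition times_bounded_op :: "'a bounded_op \<Rightarrow> 'a bounded_op \<Rightarrow> 'a bounded_op"
  is "(o\<^sub>L)"
  by simp

lift_definition one_bounded_op :: "'a bounded_op" is id_blinfun
  by simp

instance
proof
  fix S T R :: "'a bounded_op" and r :: real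
  show "S * T * R = S * (T * R)"
    by transfer (simp add: blinfun_eqI)
  show "(S + T) * R = S * R + T * R" "S * (T + R) = S * T + S * R"
    "r *\<^sub>R S * T = r *\<^sub>R (S * T)" "S * r *\<^sub>R T = r *\<^sub>R (S * T)"
    by (transfer, simp add: blinfun_eqI blinfun.bilinear_simps)+
  show "1 * S = S" "S * 1 = S"
    by (transfer, simp add: blinfun_eqI)+
  show "norm (S * T) \<le> norm S * norm T"
    by transfer (rule norm_blinfun_compose)
qed

end

lemma op_apply_times: "op_apply (S * T) x = op_apply S (op_apply T x)"
  by transfer simp

lemma op_apply_one: "op_apply 1 x = x"
  by transfer simp

lemma scaleC_times_left: "(c *\<^sub>C S) * T = c *\<^sub>C (S * T :: 'a::complex_banach bounded_op)"
  by (rule op_eqI) (simp add: op_apply_times op_apply_scaleC)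

lemma scaleC_times_right: "S * (c *\<^sub>C T) = c *\<^sub>C (S * T :: 'a::complex_banach bounded_op)"
  by (rule op_eqI) (simp add: op_apply_times op_apply_scaleC op_apply_cscale)

text \<open>The library constant \<^const>\<open>exp\<close> is given by the same series, but its type class
  requires \<open>norm 1 = 1\<close>, which fails for the trivial space.\<close>

definition op_exp :: "'a::complex_banach bounded_op \<Rightarrow> 'a bounded_op"
  where "op_exp A = (\<Sum>n. A ^ n /\<^sub>R fact n)"

definition commutator_op :: "'a::complex_banach bounded_op \<Rightarrow> 'a bounded_op bounded_op"
  where "commutator_op A = bounded_op_of (\<lambda>T. A * T - T * A)"

lemma commutator_op_apply: "op_apply (commutator_op A) T = A * T - T * A"
proof -
  have "bounded_linear (\<lambda>T. A * T - T * A)"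
    by (intro bounded_linear_sub bounded_linear_mult_left bounded_linear_mult_right)
  then show ?thesis
    by (simp add: commutator_op_def op_apply_bounded_op_of scaleC_times_left scaleC_times_right
        scaleC_diff_right)
qed


section \<open>Local spectral theory\<close>

text \<open>Analyticity of a vector-valued function on an open set is complex differentiability at
  each of its points, as for \<^const>\<open>holomorphic_on\<close>. Only used for open \<open>U\<close>.\<close>

definition vec_analytic_on :: "(complex \<Rightarrow> 'a::complex_banach) \<Rightarrow> complex set \<Rightarrow> bool"
  where "vec_analytic_on u U \<longleftrightarrow> (\<forall>z\<in>U. \<exists>D. (u has_derivative (\<lambda>h. h *\<^sub>C D)) (at z))"

definition svep :: "'a::complex_banach bounded_op \<Rightarrow> bool"
  where "svep S \<longleftrightarrow>
    (\<forall>U u. open U \<longrightarrow> vec_analytic_on u U \<longrightarrow>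
      (\<forall>z\<in>U. op_apply (z *\<^sub>C 1 - S) (u z) = 0) \<longrightarrow> (\<forall>z\<in>U. u z = 0))"

definition local_resolvent_set :: "'a::complex_banach bounded_op \<Rightarrow> 'a \<Rightarrow> complex set"
  where "local_resolvent_set S y =
    {l. \<exists>U u. open U \<and> l \<in> U \<and> vec_analytic_on u U \<and>
      (\<forall>z\<in>U. op_apply (z *\<^sub>C 1 - S) (u z) = y)}"

definition local_spectrum :: "'a::complex_banach bounded_op \<Rightarrow> 'a \<Rightarrow> complex set"
  where "local_spectrum S y = - local_resolvent_set S y"

definition local_spectral_radius :: "'a::complex_banach bounded_op \<Rightarrow> 'a \<Rightarrow> real"
  where "local_spectral_radius S y =
    (if local_spectrum S y = {} then 0 else Sup (cmod ` local_spectrum S y))"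


section \<open>The constants of the estimate\<close>

text \<open>The library has \<open>0 powr 0 = 0\<close>, whereas in the growth condition \<open>|t|\<close> to the power \<open>0\<close>
  is the constant \<open>1\<close>, also at \<open>t = 0\<close>.\<close>

definition abs_pow :: "real \<Rightarrow> real \<Rightarrow> real"
  where "abs_pow t \<alpha> = (if \<alpha> = 0 then 1 else \<bar>t\<bar> powr \<alpha>)"

definition C_const :: "real \<Rightarrow> real"
  where "C_const \<alpha> =
    (2 / pi) powr (2 - \<alpha>) * (\<Sum>\<^sub>\<infinity>k\<in>(UNIV :: int set). 1 / \<bar>2 * real_of_int k + 1\<bar> powr (2 - \<alpha>))"

end

theory Submission
  imports Defs "HOL-Complex_Analysis.Complex_Analysis" "HOL-Real_Asymp.Real_Asymp"
begin

text \<open>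
  Let \<open>S\<close> be the commutator with \<open>A\<close> and \<open>r\<close> its local spectral radius at \<open>T\<close>. The orbit
  \<open>t \<mapsto> exp (t * A) * T * exp (- t * A)\<close> is \<open>exp (t * S)\<close> applied to \<open>T\<close>
  (lemma \<open>conjugation_sums\<close>), its derivative at \<open>0\<close> is \<open>A * T - T * A\<close>, and it extends to an
  entire function. The claim is therefore a Bernstein inequality: an entire function of exponential
  type \<open>r\<close> that grows on the real line at most like \<open>C * (1 + \<bar>t\<bar> ^ \<alpha>)\<close> has a derivative at
  \<open>0\<close> of the stated size.

  A norming functional \<open>\<phi>\<close> for \<open>A * T - T * A\<close>, obtained from the Hahn-Banach theorem
  (lemma \<open>complex_norming_functional\<close>), reduces everything to a scalar function
  \<open>F z = (\<Sum>n. \<phi> (S ^ n T) * z ^ n / fact n)\<close>.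

  That \<open>F\<close> has exponential type at most \<open>\<sigma>\<close> for every \<open>\<sigma> > r\<close> is where the single-valued
  extension property enters: it makes the local solutions of \<open>(z - S) u z = T\<close> agree on overlaps, so
  that they form one analytic function outside the disc of radius \<open>r\<close>. Its expansion at infinity
  has the coefficients \<open>S ^ n T\<close>, and Cauchy's inequality gives \<open>\<phi> (S ^ n T) = O (\<sigma> ^ n)\<close>
  (lemma \<open>orbit_growth_le_local_spectral_radius\<close>).

  For the scalar inequality, scale to type one. The Phragmen-Lindelof principle in each quadrant
  combines the growth on the real line and the type into
  \<open>\<bar>F z\<bar> \<le> K * (1 + \<bar>z\<bar>) ^ \<alpha> * exp \<bar>Im z\<bar>\<close> (lemma \<open>exponential_type_bound\<close>). This suffices
  for the residue theorem to yield, as \<open>\<alpha> < 1\<close>, the interpolation formula of M. Riesz, which expresses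
  the derivative at \<open>0\<close> through the values at the zeros \<open>t k = (2 * k + 1) * pi / 2\<close> of the cosine with
  weights \<open>1 / (t k)\<^sup>2\<close> up to sign (theorem \<open>riesz_interpolation\<close>). These weights add up to \<open>1\<close>, and
  with the additional factor \<open>\<bar>t k\<bar> ^ \<alpha>\<close> they add up to the constant \<open>C_const \<alpha>\<close>. This gives both
  terms of the estimate for \<open>\<sigma>\<close>, and \<open>\<sigma>\<close> tends to \<open>r\<close> from above.
\<close>

section \<open>Norming functionals\<close>

definition sublinear :: "('a::real_vector \<Rightarrow> real) \<Rightarrow> bool"
  where "sublinear p \<longleftrightarrow>
    (\<forall>x y. p (x + y) \<le> p x + p y) \<and> (\<forall>c x. 0 < c \<longrightarrow> p (c *\<^sub>R x) \<le> c * p x)"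

lemma sublinear_add: "sublinear p \<Longrightarrow> p (x + y) \<le> p x + p y"
  by (simp add: sublinear_def)

lemma sublinear_scaleR:
  assumes "sublinear p" "0 < c"
  shows "p (c *\<^sub>R x) = c * p x"
proof (rule antisym)
  show "p (c *\<^sub>R x) \<le> c * p x"
    using assms by (simp add: sublinear_def)
  have "p (inverse c *\<^sub>R c *\<^sub>R x) \<le> inverse c * p (c *\<^sub>R x)"
    using assms unfolding sublinear_def by (metis positive_imp_inverse_positive)
  then show "c * p x \<le> p (c *\<^sub>R x)"
    using \<open>0 < c\<close> by (simp add: field_simps)
qed

lemma sublinear_zero:
  assumes "sublinear p"
  shows "p 0 = 0"
  using sublinear_scaleR[OF assms, of 2 0] by simp

lemma sublinear_minus_le:
  assumes "sublinear p"
  shows "- p (- x) \<le> p x"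
  using sublinear_add[OF assms, of x "- x"] sublinear_zero[OF assms] by simp

text \<open>Lowering a sublinear functional along the ray in direction \<open>a\<close>: for \<open>t = 1\<close> the value
  at \<open>- a\<close> drops to \<open>- p a\<close>, so that the lowered functional is linear on the line through \<open>a\<close>.\<close>

lemma sublinear_lower_along:
  assumes p: "sublinear p"
  obtains q where "sublinear q" "\<And>x. q x \<le> p x" "\<And>x. q x \<le> p (x + a) - p a"
proof -
  define q where "q x = (INF t\<in>{0..}. p (x + t *\<^sub>R a) - t * p a)" for x
  have scale: "p (t *\<^sub>R x) = t * p x" if "0 \<le> t" for t x
    using that sublinear_scaleR[OF p, of t x] sublinear_zero[OF p] by (cases "t = 0") auto
  have bdd: "bdd_below ((\<lambda>t. p (x + t *\<^sub>R a) - t * p a) ` {0..})" for x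
  proof (rule bdd_belowI2)
    fix t :: real assume "t \<in> {0..}"
    then show "- p (- x) \<le> p (x + t *\<^sub>R a) - t * p a"
      using sublinear_add[OF p, of "x + t *\<^sub>R a" "- x"] scale[of t a] by simp
  qed
  have le: "q x \<le> p (x + t *\<^sub>R a) - t * p a" if "0 \<le> t" for x t
    unfolding q_def using that by (intro cINF_lower[OF bdd]) auto
  have ge: "b \<le> q x" if "\<And>t. 0 \<le> t \<Longrightarrow> b \<le> p (x + t *\<^sub>R a) - t * p a" for b x
    unfolding q_def using that by (intro cINF_greatest) auto
  have "q (x + y) \<le> q x + q y" for x y
  proof -
    have "q (x + y) - (p (y + t *\<^sub>R a) - t * p a) \<le> q x" if "0 \<le> t" for t
    proof (rule ge)
      fix s :: real assume "0 \<le> s"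
      have "p (x + y + (s + t) *\<^sub>R a) \<le> p (x + s *\<^sub>R a) + p (y + t *\<^sub>R a)"
        using sublinear_add[OF p, of "x + s *\<^sub>R a" "y + t *\<^sub>R a"] by (simp add: algebra_simps)
      then show "q (x + y) - (p (y + t *\<^sub>R a) - t * p a) \<le> p (x + s *\<^sub>R a) - s * p a"
        using le[of "s + t" "x + y"] \<open>0 \<le> s\<close> \<open>0 \<le> t\<close> by (simp add: algebra_simps)
    qed
    then have "q (x + y) - q x \<le> q y"
      by (intro ge) (simp add: algebra_simps)
    then show ?thesis by simp
  qed
  moreover have "q (c *\<^sub>R x) \<le> c * q x" if "0 < c" for c x
  proof -
    have "q (c *\<^sub>R x) / c \<le> q x"
    proof (rule ge)
      fix t :: real assume "0 \<le> t"
      have "q (c *\<^sub>R x) \<le> p (c *\<^sub>R (x + t *\<^sub>R a)) - (c * t) * p a"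
        using le[of "c * t" "c *\<^sub>R x"] that \<open>0 \<le> t\<close> by (simp add: algebra_simps)
      also have "\<dots> = c * (p (x + t *\<^sub>R a) - t * p a)"
        using that scale[of c "x + t *\<^sub>R a"] by (simp add: right_diff_distrib)
      finally show "q (c *\<^sub>R x) / c \<le> p (x + t *\<^sub>R a) - t * p a"
        using that by (simp add: field_simps)
    qed
    then show ?thesis using that by (simp add: field_simps)
  qed
  ultimately have "sublinear q"
    by (simp add: sublinear_def)
  then show thesis
    using le[of 0] le[of 1] by (intro that) auto
qed

text \<open>Zorn's lemma applies because the pointwise infimum along a chain is again sublinear: two
  members of the chain are comparable, so one of them serves for both summands, and the values at
  \<open>x\<close> stay above \<open>- p (- x)\<close>.\<close>

lemma ex_minimal_sublinear:
  assumes p: "sublinear p"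
  obtains m where "sublinear m" "\<And>x. m x \<le> p x"
    "\<And>q. sublinear q \<Longrightarrow> (\<And>x. q x \<le> m x) \<Longrightarrow> q = m"
proof -
  define A where "A = {q. sublinear q \<and> (\<forall>x. q x \<le> p x)}"
  define P where "P = (\<lambda>q q' :: 'a \<Rightarrow> real. \<forall>x. q' x \<le> q x)"
  have "partial_order_on A (relation_of P A)"
  proof (rule partial_order_on_relation_ofI)
    show "P q q''" if "P q q'" "P q' q''" for q q' q''
      using that unfolding P_def by (meson order_trans)
    show "q = q'" if "P q q'" "P q' q" for q q'
      using that unfolding P_def fun_eq_iff by (meson order_antisym)
  qed (simp add: P_def)
  then have "\<exists>m\<in>A. \<forall>q\<in>A. P m q \<longrightarrow> q = m"
  proof (rule predicate_Zorn)
    fix C assume C: "C \<in> Chains (relation_of P A)"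
    have CA: "C \<subseteq> A" and cmp: "\<And>q q'. q \<in> C \<Longrightarrow> q' \<in> C \<Longrightarrow> P q q' \<or> P q' q"
      using C by (auto simp: Chains_def relation_of_def)
    show "\<exists>u\<in>A. \<forall>q\<in>C. P q u"
    proof (cases "C = {}")
      case True
      then show ?thesis using p by (auto simp: A_def)
    next
      case False
      define u where "u x = (INF q\<in>C. q x)" for x
      have bdd: "bdd_below ((\<lambda>q. q x) ` C)" for x
      proof (rule bdd_belowI2)
        fix q assume "q \<in> C"
        then have "sublinear q" "q (- x) \<le> p (- x)" using CA by (auto simp: A_def)
        then show "- p (- x) \<le> q x" using sublinear_minus_le[of q x] by simp
      qed
      have le: "u x \<le> q x" if "q \<in> C" for q x
        unfolding u_def using that by (intro cINF_lower[OF bdd]) auto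
      have ge: "b \<le> u x" if "\<And>q. q \<in> C \<Longrightarrow> b \<le> q x" for b x
        unfolding u_def using that False by (intro cINF_greatest) auto
      have "u (x + y) \<le> u x + u y" for x y
      proof -
        have "u (x + y) - q' y \<le> u x" if "q' \<in> C" for q'
        proof (rule ge)
          fix q assume "q \<in> C"
          have "q (x + y) \<le> q x + q y" "q' (x + y) \<le> q' x + q' y"
            using \<open>q \<in> C\<close> \<open>q' \<in> C\<close> CA by (auto simp: A_def sublinear_def)
          moreover have "P q q' \<or> P q' q" by (rule cmp) fact+
          ultimately show "u (x + y) - q' y \<le> q x"
            using le[OF \<open>q \<in> C\<close>, of "x + y"] le[OF \<open>q' \<in> C\<close>, of "x + y"]
            unfolding P_def by (smt (verit))
        qed
        then have "u (x + y) - u x \<le> u y" by (intro ge) (simp add: algebra_simps)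
        then show ?thesis by simp
      qed
      moreover have "u (c *\<^sub>R x) \<le> c * u x" if "0 < c" for c x
      proof -
        have "u (c *\<^sub>R x) / c \<le> u x"
        proof (rule ge)
          fix q assume "q \<in> C"
          then have "q (c *\<^sub>R x) = c * q x"
            using CA that by (intro sublinear_scaleR) (auto simp: A_def)
          then show "u (c *\<^sub>R x) / c \<le> q x"
            using le[OF \<open>q \<in> C\<close>, of "c *\<^sub>R x"] that by (simp add: field_simps)
        qed
        then show ?thesis using that by (simp add: field_simps)
      qed
      moreover have "u x \<le> p x" for x
      proof -
        obtain q where "q \<in> C" using False by blast
        moreover from this have "q x \<le> p x" using CA by (auto simp: A_def)
        ultimately show ?thesis using le[of q x] by simp
      qed
      ultimately have "u \<in> A" by (simp add: A_def sublinear_def)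
      then show ?thesis using le by (auto simp: P_def)
    qed
  qed
  then obtain m where m: "m \<in> A" and minimal: "\<And>q. q \<in> A \<Longrightarrow> P m q \<Longrightarrow> q = m"
    by blast
  show thesis
  proof (rule that[of m])
    fix q assume q: "sublinear q" "\<And>x. q x \<le> m x"
    have "q x \<le> p x" for x
    proof -
      have "m x \<le> p x" using m by (simp add: A_def)
      then show ?thesis using q(2)[of x] by simp
    qed
    then show "q = m" using q by (intro minimal) (auto simp: A_def P_def)
  qed (use m in \<open>auto simp: A_def\<close>)
qed

text \<open>A minimal sublinear functional is linear: lowering it along any direction \<open>a\<close> changes
  nothing, and this is exactly superadditivity in that direction.\<close>

lemma hahn_banach_sublinear:
  assumes "sublinear p"
  obtains f where "linear f" "\<And>x. f x \<le> p x"
proof -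
  obtain m where m: "sublinear m" "\<And>x. m x \<le> p x"
    and minimal: "\<And>q. sublinear q \<Longrightarrow> (\<And>x. q x \<le> m x) \<Longrightarrow> q = m"
    using ex_minimal_sublinear[OF assms] by metis
  have add: "m (x + a) = m x + m a" for x a
  proof (rule antisym)
    show "m (x + a) \<le> m x + m a" by (rule sublinear_add[OF m(1)])
    obtain q where q: "sublinear q" "\<And>x. q x \<le> m x" "\<And>x. q x \<le> m (x + a) - m a"
      using sublinear_lower_along[OF m(1)] by metis
    then have "q = m" by (intro minimal)
    then show "m x + m a \<le> m (x + a)" using q(3)[of x] by simp
  qed
  have neg: "m (- x) = - m x" for x
    using add[of x "- x"] sublinear_zero[OF m(1)] by simp
  have "m (c *\<^sub>R x) = c *\<^sub>R m x" for c x
  proof (cases c "0 :: real" rule: linorder_cases)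
    case less
    then show ?thesis using sublinear_scaleR[OF m(1), of "- c" x] neg[of "c *\<^sub>R x"] by simp
  qed (auto simp: sublinear_scaleR[OF m(1)] sublinear_zero[OF m(1)])
  then show thesis
    using add m(2) by (intro that[of m] linearI)
qed

text \<open>Lowering the norm along \<open>v\<close> first forces every linear functional below the result to
  attain the norm at \<open>v\<close>.\<close>

lemma real_norming_functional:
  fixes v :: "'a::real_normed_vector"
  obtains f :: "'a \<Rightarrow> real" where "linear f" "\<And>x. f x \<le> norm x" "norm v \<le> f v"
proof -
  have "sublinear (norm :: 'a \<Rightarrow> real)"
    by (simp add: sublinear_def norm_triangle_ineq)
  then obtain q :: "'a \<Rightarrow> real" where q: "sublinear q" "\<And>x. q x \<le> norm x"
    and qv: "\<And>x. q x \<le> norm (x + v) - norm v"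
    using sublinear_lower_along by metis
  obtain f where f: "linear f" "\<And>x. f x \<le> q x"
    using hahn_banach_sublinear[OF q(1)] by metis
  have "f (- v) \<le> - norm v" using f(2)[of "- v"] qv[of "- v"] by simp
  then have "norm v \<le> f v" by (simp add: linear_neg[OF f(1)])
  moreover have "f x \<le> norm x" for x using f(2)[of x] q(2)[of x] by simp
  ultimately show thesis using f(1) by (intro that)
qed

definition contractive_functional :: "('a::complex_banach \<Rightarrow> complex) \<Rightarrow> bool"
  where "contractive_functional \<phi> \<longleftrightarrow>
    (\<forall>x y. \<phi> (x + y) = \<phi> x + \<phi> y) \<and> (\<forall>c x. \<phi> (c *\<^sub>C x) = c * \<phi> x) \<and> (\<forall>x. cmod (\<phi> x) \<le> norm x)"

lemma complex_norming_functional: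
  fixes v :: "'a::complex_banach"
  obtains \<phi> where "contractive_functional \<phi>" "cmod (\<phi> v) = norm v"
proof -
  obtain f :: "'a \<Rightarrow> real" where f: "linear f" "\<And>x. f x \<le> norm x" "norm v \<le> f v"
    using real_norming_functional by metis
  \<comment> \<open>A complex functional is determined by its real part.\<close>
  define \<phi> where "\<phi> x = Complex (f x) (- f (\<i> *\<^sub>C x))" for x
  have fscale: "f (c *\<^sub>C x) = Re c * f x + Im c * f (\<i> *\<^sub>C x)" for c x
  proof -
    have "c *\<^sub>C x = complex_of_real (Re c) *\<^sub>C x + complex_of_real (Im c) *\<^sub>C \<i> *\<^sub>C x"
      by (metis complex_eq scaleC_add_left scaleC_scaleC mult.commute)
    then show ?thesis
      by (simp add: scaleC_of_real linear_add[OF f(1)] linear_scale[OF f(1)])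
  qed
  have add: "\<phi> (x + y) = \<phi> x + \<phi> y" for x y
    by (simp add: \<phi>_def complex_eq_iff linear_add[OF f(1)] scaleC_add_right)
  have scale: "\<phi> (c *\<^sub>C x) = c * \<phi> x" for c x
    by (simp add: \<phi>_def complex_eq_iff scaleC_scaleC fscale[of c] fscale[of "\<i> * c"])
  have le: "cmod (\<phi> x) \<le> norm x" for x
  proof (cases "\<phi> x = 0")
    case False
    \<comment> \<open>Rotating \<open>x\<close> makes the value real, hence equal to the value of \<open>f\<close> there.\<close>
    define c where "c = cnj (\<phi> x) / cmod (\<phi> x)"
    have "\<phi> (c *\<^sub>C x) = cmod (\<phi> x)"
      using False by (simp add: scale c_def complex_norm_square[symmetric] power2_eq_square mult.commute)
    then have "cmod (\<phi> x) = f (c *\<^sub>C x)" by (simp add: \<phi>_def complex_eq_iff)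
    also have "\<dots> \<le> norm (c *\<^sub>C x)" by (rule f(2))
    also have "\<dots> = norm x" using False by (simp add: norm_scaleC c_def norm_divide)
    finally show ?thesis .
  qed simp
  have "norm v \<le> cmod (\<phi> v)"
    using f(3) abs_Re_le_cmod[of "\<phi> v"] by (simp add: \<phi>_def)
  then show thesis
    using le[of v] by (intro that[of \<phi>]) (auto simp: contractive_functional_def add scale le)
qed

section \<open>The orbit of conjugation\<close>

text \<open>The binomial expansion of the iterated commutator. It holds because left and right
  multiplication by \<open>A\<close> commute; dividing by the factorials turns the binomial coefficients into
  the coefficients of a Cauchy product of two exponential series.\<close>

lemma scaled_conjugation_coefficients:
  fixes A T :: "'a::complex_banach bounded_op"
  shows "(op_apply (commutator_op A) ^^ n) T /\<^sub>R fact n =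
    (\<Sum>i\<le>n. (A ^ i /\<^sub>R fact i) * T * ((- A) ^ (n - i) /\<^sub>R fact (n - i)))"
    (is "?P n = ?Q n")
proof (induction n)
  case 0
  then show ?case by simp
next
  case (Suc n)
  let ?x = "\<lambda>m i. (A ^ i /\<^sub>R fact i) * T * ((- A) ^ (m - i) /\<^sub>R fact (m - i))"
  have fact_shift: "inverse (fact i) = real (Suc i) * inverse (fact (Suc i))" for i
    by (simp add: field_simps del: of_nat_Suc)
  have left: "A * ?x n i = real (Suc i) *\<^sub>R ?x (Suc n) (Suc i)" for i
    using fact_shift[of i] by (simp add: mult.assoc del: of_nat_Suc fact_Suc)
  have right: "- (?x n i * A) = real (Suc n - i) *\<^sub>R ?x (Suc n) i" if "i \<le> n" for i
  proof -
    obtain j where j: "n = i + j" using le_Suc_ex[OF \<open>i \<le> n\<close>] by blast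
    have "(- A) ^ Suc j = - ((- A) ^ j * A)"
      by (simp only: power_Suc2 mult_minus_right)
    then show ?thesis
      using fact_shift[of j] by (simp add: j mult.assoc Suc_diff_le del: power_Suc of_nat_Suc fact_Suc)
  qed
  have "real (Suc n) *\<^sub>R ?P (Suc n) = op_apply (commutator_op A) (?P n)"
    by (simp add: linear_scale bounded_linear.linear[OF bounded_linear_op_apply])
  also have "\<dots> = (\<Sum>i\<le>n. A * ?x n i) + (\<Sum>i\<le>n. - (?x n i * A))"
    unfolding Suc.IH by (simp add: commutator_op_apply sum_distrib_left sum_distrib_right sum_negf)
  also have "(\<Sum>i\<le>n. A * ?x n i) = (\<Sum>i\<le>Suc n. real i *\<^sub>R ?x (Suc n) i)"
    unfolding left by (subst sum.atMost_Suc_shift) simp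
  also have "(\<Sum>i\<le>n. - (?x n i * A)) = (\<Sum>i\<le>Suc n. real (Suc n - i) *\<^sub>R ?x (Suc n) i)"
    using right by simp
  also have "(\<Sum>i\<le>Suc n. real i *\<^sub>R ?x (Suc n) i) +
      (\<Sum>i\<le>Suc n. real (Suc n - i) *\<^sub>R ?x (Suc n) i) = (\<Sum>i\<le>Suc n. real (Suc n) *\<^sub>R ?x (Suc n) i)"
    unfolding sum.distrib[symmetric] scaleR_left.add[symmetric]
    by (intro sum.cong refl) (simp add: of_nat_diff)
  also have "\<dots> = real (Suc n) *\<^sub>R ?Q (Suc n)"
    by (simp only: scaleR_sum_right)
  finally show ?case
    by (rule scaleR_left_imp_eq[rotated]) simp
qed

lemma summable_norm_op_exp:
  fixes A :: "'a::complex_banach bounded_op"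
  shows "summable (\<lambda>n. norm (A ^ n /\<^sub>R fact n))"
proof (rule summable_comparison_test')
  have "norm (A ^ n) \<le> norm (1 :: 'a bounded_op) * norm A ^ n" for n
  proof (induction n)
    case (Suc n)
    have "norm (A ^ Suc n) \<le> norm A * norm (A ^ n)" by (simp add: norm_mult_ineq)
    also have "\<dots> \<le> norm A * (norm (1 :: 'a bounded_op) * norm A ^ n)"
      by (intro mult_left_mono Suc) auto
    finally show ?case by (simp add: mult_ac)
  qed simp
  then show "norm (norm (A ^ n /\<^sub>R fact n)) \<le> norm (1 :: 'a bounded_op) * (inverse (fact n) * norm A ^ n)"
    for n by (simp add: divide_right_mono field_simps)
  show "summable (\<lambda>n. norm (1 :: 'a bounded_op) * (inverse (fact n) * norm A ^ n))"
    by (intro summable_mult summable_exp)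
qed

text \<open>The one-parameter group generated by the commutator is conjugation by the group generated
  by \<open>A\<close>.\<close>

lemma conjugation_sums:
  fixes A T :: "'a::complex_banach bounded_op"
  shows "(\<lambda>n. t ^ n *\<^sub>R (op_apply (commutator_op A) ^^ n) T /\<^sub>R fact n) sums
    (op_exp (t *\<^sub>R A) * T * op_exp (- (t *\<^sub>R A)))"
proof -
  define B where "B = t *\<^sub>R A"
  have "summable (\<lambda>n. norm ((B ^ n /\<^sub>R fact n) * T))"
    by (rule summable_comparison_test'[OF summable_mult2[OF summable_norm_op_exp[of B], of "norm T"]])
      (use norm_mult_ineq in auto)
  from Cauchy_product_sums[OF this summable_norm_op_exp[of "- B"]]
  have "(\<lambda>n. (op_apply (commutator_op B) ^^ n) T /\<^sub>R fact n) sums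
      ((\<Sum>n. (B ^ n /\<^sub>R fact n) * T) * op_exp (- B))"
    by (simp only: scaled_conjugation_coefficients op_exp_def)
  also have "(\<Sum>n. (B ^ n /\<^sub>R fact n) * T) = op_exp B * T"
    unfolding op_exp_def
    by (rule bounded_linear.suminf[OF bounded_linear_mult_left summable_norm_cancel, symmetric])
      (rule summable_norm_op_exp)
  also have "(\<lambda>n. (op_apply (commutator_op B) ^^ n) T /\<^sub>R fact n) =
      (\<lambda>n. t ^ n *\<^sub>R (op_apply (commutator_op A) ^^ n) T /\<^sub>R fact n)"
  proof -
    have "(op_apply (commutator_op B) ^^ n) T = t ^ n *\<^sub>R (op_apply (commutator_op A) ^^ n) T" for n
    proof (induction n)
      case (Suc n)
      then show ?case
        by (simp add: commutator_op_apply B_def algebra_simps)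
    qed simp
    then show ?thesis by simp
  qed
  finally show ?thesis by (simp add: B_def)
qed

section \<open>Local resolvents and the growth of orbits\<close>

lemma bounded_linear_scaleC_left: "bounded_linear (\<lambda>h. h *\<^sub>C (x :: 'a::complex_banach))"
proof (rule bounded_linear_intro[where K = "norm x"])
  show "(r *\<^sub>R h) *\<^sub>C x = r *\<^sub>R h *\<^sub>C x" for r h
    by (simp add: scaleR_conv_of_real scaleC_of_real flip: scaleC_scaleC)
qed (simp_all add: scaleC_add_left norm_scaleC)

lemma op_apply_diff: "op_apply S (x - y) = op_apply S x - op_apply S y"
  by (rule linear_diff[OF bounded_linear.linear[OF bounded_linear_op_apply]])

lemma op_apply_minus: "op_apply S (- x) = - op_apply S x"
  by (rule linear_neg[OF bounded_linear.linear[OF bounded_linear_op_apply]])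

lemma op_apply_resolvent: "op_apply (z *\<^sub>C 1 - S) v = z *\<^sub>C v - op_apply S v"
proof -
  have "op_apply (z *\<^sub>C 1 - S + S) v = op_apply (z *\<^sub>C 1 - S) v + op_apply S v"
    by (rule op_apply_add)
  then show ?thesis by (simp add: op_apply_scaleC op_apply_one algebra_simps)
qed

lemma vec_analytic_on_diff:
  assumes "vec_analytic_on u U" "vec_analytic_on v U"
  shows "vec_analytic_on (\<lambda>z. u z - v z) U"
  unfolding vec_analytic_on_def
proof
  fix z assume "z \<in> U"
  then obtain D E where "(u has_derivative (\<lambda>h. h *\<^sub>C D)) (at z)"
    "(v has_derivative (\<lambda>h. h *\<^sub>C E)) (at z)"
    using assms unfolding vec_analytic_on_def by meson
  then have "((\<lambda>z. u z - v z) has_derivative (\<lambda>h. h *\<^sub>C (D - E))) (at z)"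
    unfolding scaleC_diff_right by (rule has_derivative_diff)
  then show "\<exists>D. ((\<lambda>z. u z - v z) has_derivative (\<lambda>h. h *\<^sub>C D)) (at z)" ..
qed

text \<open>Local solutions agree on overlaps by the single-valued extension property, hence glue.\<close>

lemma local_resolvent_function:
  assumes "svep S"
  obtains u where "vec_analytic_on u (local_resolvent_set S y)"
    "\<And>z. z \<in> local_resolvent_set S y \<Longrightarrow> op_apply (z *\<^sub>C 1 - S) (u z) = y"
proof -
  let ?\<rho> = "local_resolvent_set S y"
  have "\<forall>l\<in>?\<rho>. \<exists>U w. open U \<and> l \<in> U \<and> vec_analytic_on w U \<and>
      (\<forall>z\<in>U. op_apply (z *\<^sub>C 1 - S) (w z) = y)"
    by (simp add: local_resolvent_set_def)
  then obtain U W where UW: "\<And>l. l \<in> ?\<rho> \<Longrightarrow> open (U l) \<and> l \<in> U l \<and> vec_analytic_on (W l) (U l) \<and>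
      (\<forall>z\<in>U l. op_apply (z *\<^sub>C 1 - S) (W l z) = y)"
    by metis
  define u where "u z = W z z" for z
  have sub: "U l \<subseteq> ?\<rho>" if "l \<in> ?\<rho>" for l
    using UW[OF that] unfolding local_resolvent_set_def by blast
  have agree: "u z = W l z" if l: "l \<in> ?\<rho>" and z: "z \<in> U l" for l z
  proof -
    have z\<rho>: "z \<in> ?\<rho>" using sub l z by blast
    let ?V = "U l \<inter> U z"
    have "vec_analytic_on (\<lambda>x. W z x - W l x) ?V"
      using UW[OF l] UW[OF z\<rho>] by (intro vec_analytic_on_diff) (auto simp: vec_analytic_on_def)
    moreover have "op_apply (x *\<^sub>C 1 - S) (W z x - W l x) = 0" if "x \<in> ?V" for x
      using UW[OF l] UW[OF z\<rho>] that by (simp add: op_apply_diff)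
    moreover have "open ?V" using UW[OF l] UW[OF z\<rho>] by auto
    ultimately have "\<forall>x\<in>?V. W z x - W l x = 0"
      using assms unfolding svep_def by blast
    then show ?thesis using UW[OF z\<rho>] z by (simp add: u_def)
  qed
  have "vec_analytic_on u ?\<rho>"
    unfolding vec_analytic_on_def
  proof
    fix l assume l: "l \<in> ?\<rho>"
    then obtain D where D: "(W l has_derivative (\<lambda>h. h *\<^sub>C D)) (at l)"
      using UW[OF l] by (auto simp: vec_analytic_on_def)
    have "(u has_derivative (\<lambda>h. h *\<^sub>C D)) (at l)"
      by (rule has_derivative_transform_within_open[OF D, of "U l"])
        (use UW[OF l] agree[OF l] in auto)
    then show "\<exists>D. (u has_derivative (\<lambda>h. h *\<^sub>C D)) (at l)" ..
  qed
  moreover have "op_apply (z *\<^sub>C 1 - S) (u z) = y" if "z \<in> ?\<rho>" for z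
    using UW[OF that] by (simp add: u_def)
  ultimately show thesis by (rule that)
qed

text \<open>The Neumann series of the resolvent at \<open>y\<close>, written in powers of \<open>1 / z\<close> so that it is
  also the expansion at infinity of the local resolvent function.\<close>

definition neumann :: "'a::complex_banach bounded_op \<Rightarrow> 'a \<Rightarrow> complex \<Rightarrow> 'a"
  where "neumann S y z = (\<Sum>n. (1 / z) ^ Suc n *\<^sub>C (op_apply S ^^ n) y)"

lemma norm_orbit_le: "norm ((op_apply S ^^ n) y) \<le> norm S ^ n * norm y"
proof (induction n)
  case (Suc n)
  have "norm ((op_apply S ^^ Suc n) y) \<le> norm S * norm ((op_apply S ^^ n) y)"
    by (simp add: norm_op_apply)
  also have "\<dots> \<le> norm S * (norm S ^ n * norm y)"
    by (intro mult_left_mono Suc) simp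
  finally show ?case by (simp add: mult.assoc)
qed simp

lemma neumann_sums:
  assumes "norm S < cmod z"
  shows "(\<lambda>n. (1 / z) ^ Suc n *\<^sub>C (op_apply S ^^ n) y) sums neumann S y z"
proof -
  let ?q = "norm S / cmod z"
  have z: "z \<noteq> 0" "0 < cmod z" using assms norm_ge_zero[of S] by (auto simp del: norm_ge_zero)
  have "norm ((1 / z) ^ Suc n *\<^sub>C (op_apply S ^^ n) y) \<le> norm y / cmod z * ?q ^ n" for n
  proof -
    have "norm ((1 / z) ^ Suc n *\<^sub>C (op_apply S ^^ n) y) = (1 / cmod z) ^ Suc n * norm ((op_apply S ^^ n) y)"
      by (simp add: norm_scaleC norm_power norm_divide norm_mult)
    also have "\<dots> \<le> (1 / cmod z) ^ Suc n * (norm S ^ n * norm y)"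
      by (intro mult_left_mono norm_orbit_le) simp
    finally show ?thesis by (simp add: field_simps)
  qed
  moreover have "summable (\<lambda>n. norm y / cmod z * ?q ^ n)"
    using assms z by (intro summable_mult summable_geometric) simp
  ultimately show ?thesis
    unfolding neumann_def by (blast intro: summable_sums summable_comparison_test')
qed

lemma neumann_solves:
  assumes "norm S < cmod z"
  shows "op_apply (z *\<^sub>C 1 - S) (neumann S y z) = y"
proof -
  define f where "f n = (1 / z) ^ n *\<^sub>C (op_apply S ^^ n) y" for n
  have z: "z \<noteq> 0" using assms norm_ge_zero[of S] by (auto simp del: norm_ge_zero)
  let ?x = "\<lambda>n. (1 / z) ^ Suc n *\<^sub>C (op_apply S ^^ n) y"
  have fx: "f = (\<lambda>n. z *\<^sub>C ?x n)"
    using z by (auto simp: f_def scaleC_scaleC)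
  have "?x \<longlonglongrightarrow> 0"
    using neumann_sums[OF assms] by (intro summable_LIMSEQ_zero sums_summable)
  then have "f \<longlonglongrightarrow> 0"
    unfolding fx using bounded_linear.tendsto[OF bounded_linear_scaleC, of ?x 0 _ z] by simp
  from telescope_sums'[OF this] have "(\<lambda>n. f n - f (Suc n)) sums f 0" by simp
  moreover have "op_apply (z *\<^sub>C 1 - S) (?x n) = f n - f (Suc n)" for n
    using z by (simp add: op_apply_resolvent f_def op_apply_cscale scaleC_scaleC scaleC_diff_right)
  moreover have "(\<lambda>n. op_apply (z *\<^sub>C 1 - S) (?x n)) sums op_apply (z *\<^sub>C 1 - S) (neumann S y z)"
    by (rule bounded_linear.sums[OF bounded_linear_op_apply neumann_sums[OF assms]])
  ultimately have "op_apply (z *\<^sub>C 1 - S) (neumann S y z) = f 0"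
    using sums_unique2 by simp
  then show ?thesis by (simp add: f_def)
qed

lemma norm_resolvent_apply_ge: "(cmod z - norm S) * norm v \<le> norm (op_apply (z *\<^sub>C 1 - S) v)"
proof -
  have "norm (z *\<^sub>C v) \<le> norm (z *\<^sub>C v - op_apply S v) + norm (op_apply S v)"
    using norm_triangle_ineq[of "z *\<^sub>C v - op_apply S v" "op_apply S v"] by simp
  then show ?thesis
    using norm_op_apply[of S v] by (simp add: op_apply_resolvent norm_scaleC algebra_simps)
qed

lemma neumann_unique:
  assumes "norm S < cmod z" "op_apply (z *\<^sub>C 1 - S) v = y"
  shows "v = neumann S y z"
proof -
  have "(cmod z - norm S) * norm (v - neumann S y z) \<le> 0"
    using norm_resolvent_apply_ge[of z S "v - neumann S y z"] assms
    by (simp add: op_apply_diff neumann_solves)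
  then show ?thesis using assms(1) by (simp add: mult_le_0_iff)
qed

text \<open>The derivative at \<open>a\<close> is minus the square of the resolvent applied to \<open>y\<close>. By the resolvent
  identity, \<open>a + h\<close> minus \<open>S\<close> maps the first-order remainder to \<open>h * h\<close> times a fixed vector, and the
  lower bound for this operator makes the remainder quadratic in \<open>h\<close>.\<close>

lemma vec_analytic_on_neumann: "vec_analytic_on (neumann S y) {z. norm S < cmod z}"
  unfolding vec_analytic_on_def
proof
  fix a assume "a \<in> {z. norm S < cmod z}"
  then have a: "norm S < cmod a" by simp
  define d where "d = (cmod a - norm S) / 2"
  have "d > 0" using a by (simp add: d_def)
  define v where "v = neumann S y a"
  define x where "x = neumann S v a"
  have quadratic: "norm (neumann S y (a + h) - v - h *\<^sub>C (- x)) \<le> norm x / d * (cmod h)\<^sup>2"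
    if h: "cmod h < d" for h
  proof -
    have "cmod a \<le> cmod (a + h) + cmod h"
      using norm_triangle_ineq4[of "a + h" h] by simp
    then have gap: "d \<le> cmod (a + h) - norm S"
      using h by (simp add: d_def field_simps)
    then have ah: "norm S < cmod (a + h)" using \<open>d > 0\<close> by simp
    let ?e = "neumann S y (a + h) - v - h *\<^sub>C (- x)"
    have shift: "op_apply ((a + h) *\<^sub>C 1 - S) w = op_apply (a *\<^sub>C 1 - S) w + h *\<^sub>C w" for w
      by (simp only: op_apply_resolvent) (simp add: scaleC_add_left)
    have "op_apply ((a + h) *\<^sub>C 1 - S) ?e = y - (y + h *\<^sub>C v) - (h *\<^sub>C (- v) + h *\<^sub>C h *\<^sub>C (- x))"
    proof -
      have "op_apply ((a + h) *\<^sub>C 1 - S) (neumann S y (a + h)) = y"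
        by (rule neumann_solves[OF ah])
      moreover have "op_apply ((a + h) *\<^sub>C 1 - S) v = y + h *\<^sub>C v"
        using neumann_solves[OF a, of y] by (simp add: shift v_def)
      moreover have "op_apply ((a + h) *\<^sub>C 1 - S) (- x) = - v + h *\<^sub>C (- x)"
        using neumann_solves[OF a, of v] by (simp only: shift x_def op_apply_minus) (simp add: scaleC_minus_right)
      ultimately show ?thesis
        by (simp only: op_apply_diff op_apply_cscale) (simp add: scaleC_diff_right scaleC_minus_right)
    qed
    also have "\<dots> = (h * h) *\<^sub>C x"
      by (simp add: scaleC_minus_right scaleC_scaleC)
    finally have "d * norm ?e \<le> (cmod h)\<^sup>2 * norm x"
      using norm_resolvent_apply_ge[of "a + h" S ?e] mult_right_mono[OF gap norm_ge_zero[of ?e]]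
      by (simp add: norm_scaleC norm_mult power2_eq_square)
    then show ?thesis using \<open>d > 0\<close> by (simp add: field_simps)
  qed
  have "(neumann S y has_derivative (\<lambda>h. h *\<^sub>C (- x))) (at a)"
    unfolding has_derivative_at
  proof
    show "(\<lambda>h. norm (neumann S y (a + h) - neumann S y a - h *\<^sub>C (- x)) / norm h) \<midarrow>0\<rightarrow> 0"
    proof (rule Lim_null_comparison)
      show "(\<lambda>h. norm x / d * cmod h) \<midarrow>0\<rightarrow> 0"
        by (rule tendsto_eq_intros refl | simp)+
      have "norm (norm (neumann S y (a + h) - neumann S y a - h *\<^sub>C (- x)) / norm h) \<le> norm x / d * cmod h"
        if "cmod h < d" for h
        using quadratic[OF that] by (simp add: v_def divide_le_eq power2_eq_square mult.assoc)
      then show "\<forall>\<^sub>F h in at 0. norm (norm (neumann S y (a + h) - neumann S y a - h *\<^sub>C (- x)) / norm h)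
          \<le> norm x / d * cmod h"
        using \<open>d > 0\<close> by (auto simp: eventually_at dist_norm)
    qed
  qed (rule bounded_linear_scaleC_left)
  then show "\<exists>D. (neumann S y has_derivative (\<lambda>h. h *\<^sub>C D)) (at a)" ..
qed

lemma outside_norm_in_local_resolvent_set:
  assumes "norm S < cmod z"
  shows "z \<in> local_resolvent_set S y"
proof -
  have "open {z :: complex. norm S < cmod z}"
    by (intro open_Collect_less continuous_intros)
  then show ?thesis
    using vec_analytic_on_neumann[of S y] neumann_solves[of S _ y] assms
    unfolding local_resolvent_set_def by blast
qed

lemma local_spectrum_le_norm: "z \<in> local_spectrum S y \<Longrightarrow> cmod z \<le> norm S"
  using outside_norm_in_local_resolvent_set[of S z y] by (force simp: local_spectrum_def)

text \<open>The supremum in the definition of the radius is meaningful since the local spectrum is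
  bounded.\<close>

lemma local_spectrum_le_radius:
  assumes "z \<in> local_spectrum S y"
  shows "cmod z \<le> local_spectral_radius S y"
proof -
  have "bdd_above (cmod ` local_spectrum S y)"
    by (rule bdd_aboveI2[OF local_spectrum_le_norm])
  then show ?thesis
    using assms cSUP_upper[OF assms, of cmod] by (auto simp: local_spectral_radius_def)
qed

lemma local_spectral_radius_nonneg: "0 \<le> local_spectral_radius S y"
proof (cases "local_spectrum S y = {}")
  case False
  then obtain z where "z \<in> local_spectrum S y" by blast
  then show ?thesis using local_spectrum_le_radius[of z S y] norm_ge_zero[of z] by linarith
qed (simp add: local_spectral_radius_def)

lemma contractive_functional_bounded_linear:
  assumes "contractive_functional \<phi>"
  shows "bounded_linear \<phi>"
proof (rule bounded_linear_intro[where K = 1])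
  show "\<phi> (r *\<^sub>R x) = r *\<^sub>R \<phi> x" for r x
  proof -
    have "\<phi> (complex_of_real r *\<^sub>C x) = complex_of_real r * \<phi> x"
      using assms by (simp add: contractive_functional_def)
    then show ?thesis by (simp add: scaleC_of_real scaleR_conv_of_real)
  qed
qed (use assms in \<open>auto simp: contractive_functional_def\<close>)

text \<open>Composed with \<open>\<phi>\<close> and with inversion, the glued local resolvent becomes a scalar function
  \<open>g\<close> holomorphic in the disc of radius \<open>1 / s\<close> for every \<open>s\<close> above the local spectral radius. The
  Neumann series near \<open>0\<close> identifies its Taylor coefficients, shifted by one index, as the
  numbers to be estimated, so that Cauchy's inequality on the larger disc bounds them.\<close>

lemma orbit_growth_le_local_spectral_radius:
  assumes "svep S" and \<phi>: "contractive_functional \<phi>" and "local_spectral_radius S y < \<sigma>"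
  obtains B where "\<And>n. cmod (\<phi> ((op_apply S ^^ n) y)) \<le> B * \<sigma> ^ n"
proof -
  note bl = contractive_functional_bounded_linear[OF \<phi>]
  have \<phi>C: "\<phi> (c *\<^sub>C x) = c * \<phi> x" for c x
    using \<phi> by (simp add: contractive_functional_def)
  \<comment> \<open>A radius strictly between leaves room for the closed disc of radius \<open>1 / \<sigma>\<close> in the open one.\<close>
  define s where "s = (local_spectral_radius S y + \<sigma>) / 2"
  have s: "local_spectral_radius S y < s" "s < \<sigma>" "0 < s" "0 < \<sigma>"
    using assms(3) local_spectral_radius_nonneg[of S y] by (auto simp: s_def)
  obtain u where an: "vec_analytic_on u (local_resolvent_set S y)"
    and sol: "\<And>z. z \<in> local_resolvent_set S y \<Longrightarrow> op_apply (z *\<^sub>C 1 - S) (u z) = y"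
    by (rule local_resolvent_function[OF assms(1), of y]) blast
  have \<rho>: "z \<in> local_resolvent_set S y" if "s < cmod z" for z
    using local_spectrum_le_radius[of z S y] that s(1) by (force simp: local_spectrum_def)
  define g where "g \<zeta> = (if \<zeta> = 0 then 0 else \<phi> (u (1 / \<zeta>)))" for \<zeta>
  define F where "F = Abs_fps (\<lambda>n. case n of 0 \<Rightarrow> 0 | Suc k \<Rightarrow> \<phi> ((op_apply S ^^ k) y))"
  define e where "e = 1 / (norm S + 1)"
  have "e > 0" by (simp add: e_def add_nonneg_pos)
  have near0: "(\<lambda>n. fps_nth F n * \<zeta> ^ n) sums g \<zeta>" if "\<zeta> \<in> ball 0 e" for \<zeta>
  proof (cases "\<zeta> = 0")
    case True
    have "(\<lambda>n. fps_nth F n * 0 ^ n) sums (fps_nth F 0)" by (rule powser_sums_zero)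
    then show ?thesis using True by (simp add: g_def F_def)
  next
    case False
    have "cmod \<zeta> < 1 / (norm S + 1)"
      using that by (simp add: e_def)
    then have "cmod \<zeta> * (norm S + 1) < 1"
      using pos_less_divide_eq[of "norm S + 1" "cmod \<zeta>" 1] by (simp add: add_nonneg_pos)
    then have "norm S + 1 < cmod (1 / \<zeta>)"
      using False by (simp add: norm_divide field_simps)
    then have big: "norm S < cmod (1 / \<zeta>)" by simp
    have "u (1 / \<zeta>) = neumann S y (1 / \<zeta>)"
      by (rule neumann_unique[OF big sol[OF outside_norm_in_local_resolvent_set[OF big]]])
    with bounded_linear.sums[OF bl neumann_sums[OF big, of y]]
    have "(\<lambda>n. fps_nth F (Suc n) * \<zeta> ^ Suc n) sums g \<zeta>"
      using False by (simp add: \<phi>C g_def F_def mult.commute)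
    then show ?thesis by (subst (asm) sums_Suc_iff) (simp add: F_def)
  qed
  have "g holomorphic_on ball 0 e"
    by (rule power_series_holomorphic[where a = "fps_nth F"]) (use near0 in simp)
  moreover have "g holomorphic_on ball 0 (1 / s) - {0}"
  proof -
    have "g field_differentiable at \<zeta>" if \<zeta>: "\<zeta> \<in> ball 0 (1 / s) - {0}" for \<zeta>
    proof -
      have "s < cmod (1 / \<zeta>)" using \<zeta> s by (simp add: norm_divide field_simps)
      then obtain D where "(u has_derivative (\<lambda>h. h *\<^sub>C D)) (at (1 / \<zeta>))"
        using an \<rho> by (auto simp: vec_analytic_on_def)
      moreover have "(\<lambda>h. h * \<phi> D) = (*) (\<phi> D)"
        by (simp add: fun_eq_iff)
      ultimately have "((\<lambda>z. \<phi> (u z)) has_field_derivative \<phi> D) (at (1 / \<zeta>))"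
        using bounded_linear.has_derivative[OF bl] by (fastforce simp: \<phi>C has_field_derivative_def)
      moreover have "((\<lambda>\<zeta>. 1 / \<zeta>) has_field_derivative - 1 / \<zeta>\<^sup>2) (at \<zeta>)"
        using \<zeta> by (auto intro!: derivative_eq_intros simp: power2_eq_square)
      ultimately have "((\<lambda>\<zeta>. \<phi> (u (1 / \<zeta>))) has_field_derivative \<phi> D * (- 1 / \<zeta>\<^sup>2)) (at \<zeta>)"
        by (rule DERIV_chain2)
      then have "(g has_field_derivative \<phi> D * (- 1 / \<zeta>\<^sup>2)) (at \<zeta>)"
        by (rule has_field_derivative_transform_within_open[of _ _ _ "- {0}"])
          (use \<zeta> in \<open>auto simp: g_def\<close>)
      then show ?thesis
        by (auto simp: field_differentiable_def)
    qed
    then show ?thesis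
      by (auto simp: holomorphic_on_def intro: field_differentiable_at_within)
  qed
  ultimately have "g holomorphic_on ball 0 e \<union> (ball 0 (1 / s) - {0})"
    by (intro holomorphic_on_Un) auto
  then have holo: "g holomorphic_on ball 0 (1 / s)"
    by (rule holomorphic_on_subset) (use \<open>e > 0\<close> in auto)
  have "g has_fps_expansion F"
    by (rule has_fps_expansionI)
      (use near0 \<open>e > 0\<close> in \<open>auto simp: eventually_nhds_metric dist_commute intro!: exI[of _ e]\<close>)
  note coeff = fps_nth_fps_expansion[OF this]
  have le: "1 / \<sigma> < 1 / s" using s by (simp add: frac_less2)
  have hcb: "g holomorphic_on cball 0 (1 / \<sigma>)"
    by (rule holomorphic_on_subset[OF holo]) (use le in auto)
  then have "compact (g ` cball 0 (1 / \<sigma>))"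
    by (intro compact_continuous_image holomorphic_on_imp_continuous_on) auto
  then obtain M where M: "\<And>z. z \<in> cball 0 (1 / \<sigma>) \<Longrightarrow> cmod (g z) \<le> M"
    by (meson bounded_iff compact_imp_bounded imageI)
  show thesis
  proof (rule that)
    fix n
    have "cmod ((deriv ^^ Suc n) g 0) \<le> fact (Suc n) * M / (1 / \<sigma>) ^ Suc n"
    proof (rule Cauchy_inequality)
      show "g holomorphic_on ball 0 (1 / \<sigma>)" by (rule holomorphic_on_subset[OF hcb]) auto
    qed (use hcb holomorphic_on_imp_continuous_on s M in auto)
    then have "cmod (fps_nth F (Suc n)) \<le> M * \<sigma> ^ Suc n"
      unfolding coeff using s
      by (simp add: norm_divide power_one_over field_simps del: fact_Suc funpow.simps power_Suc)
    then show "cmod (\<phi> ((op_apply S ^^ n) y)) \<le> (M * \<sigma>) * \<sigma> ^ n"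
      by (simp add: F_def mult.assoc)
  qed
qed

section \<open>The Phragmen-Lindelof principle in a quadrant\<close>

text \<open>In the sector \<open>\<bar>arg w\<bar> \<le> pi / 4\<close> the power \<open>w\<close> to the \<open>3 / 2\<close>, written as the cube of the
  square root, has real part comparable to its modulus, since its argument is at
  most \<open>3 * pi / 8\<close>. The estimates use the coarse bound \<open>\<bar>Im\<bar> \<le> Re / 2\<close> for the root instead of the
  tangent of \<open>pi / 8\<close>.\<close>

lemma csqrt_cubed_in_sector:
  assumes "\<bar>Im w\<bar> \<le> Re w"
  shows "(Re (csqrt w)) ^ 3 / 4 \<le> Re (csqrt w ^ 3)"
    and "cmod w \<le> 5 / 4 * (Re (csqrt w))\<^sup>2"
proof -
  define a b where "a = Re (csqrt w)" and "b = Im (csqrt w)"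
  have s: "csqrt w = Complex a b" by (simp only: a_def b_def complex_surj)
  have a: "0 \<le> a" using csqrt_principal[of w] by (auto simp: a_def)
  have "w = (Complex a b)\<^sup>2" by (simp flip: s)
  then have w: "Re w = a\<^sup>2 - b\<^sup>2" "Im w = 2 * a * b"
    by (simp_all add: power2_eq_square)
  have "\<bar>b\<bar> \<le> a / 2"
  proof (rule ccontr)
    assume *: "\<not> \<bar>b\<bar> \<le> a / 2"
    then have "0 < b\<^sup>2" "a * a \<le> 2 * a * \<bar>b\<bar>" using a mult_left_mono[of a "2 * \<bar>b\<bar>" a] by auto
    then show False using assms a by (simp add: w abs_mult power2_eq_square)
  qed
  then have "b\<^sup>2 \<le> (a / 2)\<^sup>2"
    using a by (metis abs_le_square_iff abs_of_nonneg divide_nonneg_nonneg zero_le_numeral)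
  then have b2: "b\<^sup>2 \<le> a\<^sup>2 / 4" by (simp add: power_divide)
  have "Re (csqrt w ^ 3) = a * (a\<^sup>2 - 3 * b\<^sup>2)"
    by (simp add: s power3_eq_cube power2_eq_square algebra_simps)
  also have "\<dots> \<ge> a * (a\<^sup>2 / 4)"
    using b2 by (intro mult_left_mono a) simp
  finally show "a ^ 3 / 4 \<le> Re (csqrt w ^ 3)"
    by (simp add: power3_eq_cube power2_eq_square)
  have "cmod w = (cmod (csqrt w))\<^sup>2" by (simp flip: norm_power)
  also have "\<dots> = a\<^sup>2 + b\<^sup>2" by (simp add: s cmod_power2)
  finally show "cmod w \<le> 5 / 4 * a\<^sup>2" using b2 by simp
qed

text \<open>The Phragmen-Lindelof principle for order one in a quadrant, whose critical order is two. An
  intermediate power, here \<open>3 / 2\<close>, of the rotated and shifted variable \<open>1 + (1 - \<i>) * z\<close> gives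
  a damping factor that beats the growth of \<open>g\<close>, so that the maximum principle applies on large
  squares; then the damping is removed by letting \<open>\<epsilon>\<close> tend to \<open>0\<close>. The shift by \<open>1\<close> keeps the
  argument of the square root off the branch cut, including at the corner.\<close>

lemma phragmen_lindelof_quadrant:
  assumes holo: "g holomorphic_on {z. 0 < Re z \<and> 0 < Im z}"
    and cont: "continuous_on {z. 0 \<le> Re z \<and> 0 \<le> Im z} g"
    and growth: "\<And>z. 0 \<le> Re z \<Longrightarrow> 0 \<le> Im z \<Longrightarrow> cmod (g z) \<le> M * exp (K * cmod z)"
    and re: "\<And>x. 0 \<le> x \<Longrightarrow> cmod (g (of_real x)) \<le> B"
    and im: "\<And>y. 0 \<le> y \<Longrightarrow> cmod (g (\<i> * of_real y)) \<le> B"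
    and "0 < B" "0 \<le> K" "0 \<le> Re z" "0 \<le> Im z"
  shows "cmod (g z) \<le> B"
proof -
  define s where "s z = csqrt (1 + (1 - \<i>) * z)" for z
  have sector: "\<bar>Im (1 + (1 - \<i>) * z)\<bar> \<le> Re (1 + (1 - \<i>) * z)" "cmod z \<le> cmod (1 + (1 - \<i>) * z)"
    if "0 \<le> Re z" "0 \<le> Im z" for z
  proof -
    have "cmod z \<le> Re z + Im z" using cmod_le[of z] that by simp
    also have "\<dots> \<le> Re (1 + (1 - \<i>) * z)" by simp
    also have "\<dots> \<le> cmod (1 + (1 - \<i>) * z)" by (rule complex_Re_le_cmod)
    finally show "cmod z \<le> cmod (1 + (1 - \<i>) * z)" .
  qed (use that in auto)
  have cubic: "(Re (s z)) ^ 3 / 4 \<le> Re (s z ^ 3)" and size: "cmod z \<le> 5 / 4 * (Re (s z))\<^sup>2"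
    and nonneg: "0 \<le> Re (s z)" if "0 \<le> Re z" "0 \<le> Im z" for z
    using csqrt_cubed_in_sector[OF sector(1)[OF that]] sector(2)[OF that]
      csqrt_principal[of "1 + (1 - \<i>) * z"] by (auto simp: s_def)
  have off: "1 + (1 - \<i>) * z \<notin> \<real>\<^sub>\<le>\<^sub>0" if "0 \<le> Re z" "0 \<le> Im z" for z
    using that by (auto simp: complex_nonpos_Reals_iff)
  have damped: "cmod (g z) \<le> B * exp (\<epsilon> * Re (s z ^ 3))" if "0 < \<epsilon>" for \<epsilon>
  proof -
    define h where "h z = g z * exp (- of_real \<epsilon> * s z ^ 3)" for z
    have norm_h: "cmod (h z) = cmod (g z) * exp (- \<epsilon> * Re (s z ^ 3))" for z
      by (simp add: h_def norm_mult)
    \<comment> \<open>The third entry lets the damping win over the growth, the fourth brings the constant \<open>M\<close> down to \<open>B\<close>.\<close>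
    define R where "R = Max {Re z, Im z, 5 / 4 * ((5 * K + 4) / \<epsilon>)\<^sup>2, 5 / 4 * (M / B)}"
    have R: "Re z \<le> R" "Im z \<le> R" "5 / 4 * ((5 * K + 4) / \<epsilon>)\<^sup>2 \<le> R" "5 / 4 * (M / B) \<le> R"
      by (simp_all add: R_def)
    have far: "cmod (h w) \<le> B" if w: "0 \<le> Re w" "0 \<le> Im w" "R \<le> cmod w" for w
    proof -
      define a where "a = Re (s w)"
      have a: "0 \<le> a" using nonneg[OF w(1,2)] by (simp add: a_def)
      have ra: "R \<le> 5 / 4 * a\<^sup>2" using size[OF w(1,2)] w(3) by (simp add: a_def)
      have "((5 * K + 4) / \<epsilon>)\<^sup>2 \<le> a\<^sup>2" and aMB: "M / B \<le> a\<^sup>2" using ra R by simp_all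
      then have "(5 * K + 4) / \<epsilon> \<le> a" using a power2_le_imp_le by blast
      then have "5 * K + 4 \<le> \<epsilon> * a" using \<open>0 < \<epsilon>\<close> by (simp add: field_simps)
      then have "a\<^sup>2 * (5 * K + 4) \<le> a\<^sup>2 * (\<epsilon> * a)" by (intro mult_left_mono) auto
      moreover have "K * cmod w \<le> K * (5 / 4 * a\<^sup>2)"
        using size[OF w(1,2)] \<open>0 \<le> K\<close> by (intro mult_left_mono) (auto simp: a_def)
      moreover have "\<epsilon> * (a ^ 3 / 4) \<le> \<epsilon> * Re (s w ^ 3)"
        using cubic[OF w(1,2)] \<open>0 < \<epsilon>\<close> by (intro mult_left_mono) (auto simp: a_def)
      ultimately have expo: "K * cmod w - \<epsilon> * Re (s w ^ 3) \<le> - a\<^sup>2"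
        by (simp add: power2_eq_square power3_eq_cube algebra_simps)
      have "0 \<le> M * exp (K * cmod w)" using growth[OF w(1,2)] norm_ge_zero order_trans by blast
      then have "0 \<le> M" by (simp add: zero_le_mult_iff)
      have "cmod (h w) \<le> M * exp (K * cmod w) * exp (- \<epsilon> * Re (s w ^ 3))"
        unfolding norm_h by (intro mult_right_mono growth w) simp
      also have "\<dots> = M * exp (K * cmod w - \<epsilon> * Re (s w ^ 3))"
        by (simp add: exp_diff exp_minus divide_inverse)
      also have "\<dots> \<le> M * exp (- a\<^sup>2)"
        using expo \<open>0 \<le> M\<close> by (intro mult_left_mono) auto
      also have "\<dots> \<le> B"
      proof -
        have "M / B \<le> exp (a\<^sup>2)" using aMB exp_ge_add_one_self[of "a\<^sup>2"] by linarith
        then show ?thesis using \<open>0 < B\<close> by (simp add: exp_minus field_simps)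
      qed
      finally show ?thesis .
    qed
    have near: "cmod (h w) \<le> B" if w: "0 \<le> Re w" "0 \<le> Im w" "Re w = 0 \<or> Im w = 0" for w
    proof -
      have "cmod (g w) \<le> B"
        using w(3)
      proof
        assume "Re w = 0"
        then have "w = \<i> * of_real (Im w)" by (simp add: complex_eq_iff)
        then show ?thesis using im[OF w(2)] by simp
      next
        assume "Im w = 0"
        then have "w = of_real (Re w)" by (simp add: complex_eq_iff)
        then show ?thesis using re[OF w(1)] by simp
      qed
      moreover have "0 \<le> Re (s w ^ 3)"
        using cubic[OF w(1,2)] nonneg[OF w(1,2)] by (meson divide_nonneg_pos order_trans zero_le_power zero_less_numeral)
      then have "exp (- \<epsilon> * Re (s w ^ 3)) \<le> 1" using \<open>0 < \<epsilon>\<close> by simp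
      ultimately show ?thesis
        unfolding norm_h using mult_mono[of "cmod (g w)" B "exp (- \<epsilon> * Re (s w ^ 3))" 1] \<open>0 < B\<close> by simp
    qed
    let ?Q = "cbox 0 (Complex R R)"
    have "cmod (h z) \<le> B"
    proof (rule maximum_modulus_frontier[where f = h and S = ?Q])
      have "h holomorphic_on {z. 0 < Re z \<and> 0 < Im z}"
        unfolding h_def s_def using off
        by (intro holomorphic_intros holo) auto
      then show "h holomorphic_on interior ?Q"
        by (rule holomorphic_on_subset) (auto simp: in_box_complex_iff)
      have "continuous_on {z. 0 \<le> Re z \<and> 0 \<le> Im z} h"
        unfolding h_def
      proof (intro continuous_on_mult cont holomorphic_on_imp_continuous_on)
        show "(\<lambda>z. exp (- of_real \<epsilon> * s z ^ 3)) holomorphic_on {z. 0 \<le> Re z \<and> 0 \<le> Im z}"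
          unfolding s_def using off by (intro holomorphic_intros) auto
      qed
      then show "continuous_on (closure ?Q) h"
        by (rule continuous_on_subset) (auto simp: in_cbox_complex_iff)
      show "bounded ?Q" by (rule bounded_cbox)
      show "z \<in> ?Q" using assms R by (simp add: in_cbox_complex_iff)
      fix w assume "w \<in> frontier ?Q"
      then have w: "0 \<le> Re w" "0 \<le> Im w" and "Re w = 0 \<or> Im w = 0 \<or> Re w = R \<or> Im w = R"
        by (auto simp: frontier_cbox in_cbox_complex_iff in_box_complex_iff)
      then show "cmod (h w) \<le> B"
        using near[OF w] far[OF w] complex_Re_le_cmod[of w] abs_Im_le_cmod[of w] by force
    qed
    then show ?thesis unfolding norm_h by (simp add: exp_minus field_simps)
  qed
  have "((\<lambda>\<epsilon>. B * exp (\<epsilon> * Re (s z ^ 3))) \<longlongrightarrow> B * exp (0 * Re (s z ^ 3))) (at_right 0)"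
    by (intro tendsto_intros)
  moreover have "\<forall>\<^sub>F \<epsilon> in at_right 0. cmod (g z) \<le> B * exp (\<epsilon> * Re (s z ^ 3))"
    using damped by (auto simp: eventually_at_right_field intro!: exI[of _ 1])
  ultimately show ?thesis
    using tendsto_lowerbound by fastforce
qed

lemma holomorphic_on_reflect:
  assumes "H holomorphic_on UNIV"
  shows "(\<lambda>z. H (- z)) holomorphic_on UNIV"
proof -
  have "(\<lambda>z :: complex. - z) holomorphic_on UNIV" by (intro holomorphic_intros)
  from holomorphic_on_compose_gen[OF this assms] show ?thesis by (simp add: o_def)
qed

text \<open>The factor \<open>exp (\<i> * z)\<close> compensates the type along the imaginary axis and is unimodular
  on the real axis; the power of \<open>1 + z\<close> compensates the growth along the real axis. The product is
  therefore bounded on both edges of the quadrant.\<close>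

lemma exponential_type_in_quadrant:
  assumes holo: "G holomorphic_on UNIV"
    and type: "\<And>z. cmod (G z) \<le> M * exp (cmod z)"
    and re: "\<And>x. 0 \<le> x \<Longrightarrow> cmod (G (of_real x)) \<le> K * (1 + x) powr \<alpha>"
    and "0 \<le> \<alpha>" "0 < K" "M \<le> K" "0 \<le> Re z" "0 \<le> Im z"
  shows "cmod (G z) \<le> K * (1 + cmod z) powr \<alpha> * exp (Im z)"
proof -
  define h where "h z = G z * exp (\<i> * z) * (1 + z) powr (- of_real \<alpha>)" for z
  have norm_h: "cmod (h z) = cmod (G z) * exp (- Im z) * cmod (1 + z) powr (- \<alpha>)" for z
    by (simp add: h_def norm_mult norm_powr_real_powr')
  have ge1: "1 \<le> cmod (1 + z)" if "0 \<le> Re z" for z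
    using complex_Re_le_cmod[of "1 + z"] that by simp
  have small: "cmod (1 + z) powr (- \<alpha>) \<le> 1" if "0 \<le> Re z" for z
    using ge1[OF that] \<open>0 \<le> \<alpha>\<close> by (simp add: powr_minus inverse_le_1_iff ge_one_powr_ge_zero)
  have off: "1 + z \<notin> \<real>\<^sub>\<le>\<^sub>0" if "0 \<le> Re z" for z
    using that by (auto simp: complex_nonpos_Reals_iff)
  have "0 \<le> M * exp (cmod 0)" using type[of 0] norm_ge_zero order_trans by blast
  then have "0 \<le> M" by simp
  have growth: "cmod (h z) \<le> M * exp (cmod z) * exp (- Im z)" if "0 \<le> Re z" for z
    unfolding norm_h using mult_mono[OF mult_right_mono[OF type[of z], of "exp (- Im z)"] small[OF that]] \<open>0 \<le> M\<close>
    by simp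
  have "cmod (h z) \<le> K"
  proof (rule phragmen_lindelof_quadrant[where g = h and M = M and K = 1])
    have hol: "h holomorphic_on {z. 0 \<le> Re z}"
      unfolding h_def using off
      by (intro holomorphic_intros holomorphic_on_subset[OF holo]) auto
    then show "h holomorphic_on {z. 0 < Re z \<and> 0 < Im z}"
      by (rule holomorphic_on_subset) auto
    show "continuous_on {z. 0 \<le> Re z \<and> 0 \<le> Im z} h"
      by (rule continuous_on_subset[OF holomorphic_on_imp_continuous_on[OF hol]]) auto
    show "cmod (h z) \<le> M * exp (1 * cmod z)" if z: "0 \<le> Re z" "0 \<le> Im z" for z
    proof -
      have "M * exp (cmod z) * exp (- Im z) \<le> M * exp (cmod z) * 1"
        using z \<open>0 \<le> M\<close> by (intro mult_left_mono) auto
      then show ?thesis using growth[OF z(1)] by simp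
    qed
    show "cmod (h (of_real x)) \<le> K" if "0 \<le> x" for x
    proof -
      have "cmod (1 + of_real x :: complex) = 1 + x"
        using that by (metis abs_of_nonneg add_nonneg_nonneg norm_of_real of_real_1 of_real_add zero_le_one)
      then have "cmod (h (of_real x)) \<le> K * (1 + x) powr \<alpha> * (1 + x) powr (- \<alpha>)"
        unfolding norm_h using re[OF that] by (simp add: mult_right_mono)
      also have "\<dots> = K" using that by (simp add: powr_minus)
      finally show ?thesis .
    qed
    show "cmod (h (\<i> * of_real y)) \<le> K" if "0 \<le> y" for y
      using growth[of "\<i> * of_real y"] that \<open>M \<le> K\<close> by (simp add: norm_mult exp_minus field_simps)
  qed (use assms in auto)
  then have "cmod (G z) \<le> K * cmod (1 + z) powr \<alpha> * exp (Im z)"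
  proof -
    have pos: "0 < exp (Im z) * cmod (1 + z) powr \<alpha>"
      using ge1[OF \<open>0 \<le> Re z\<close>] by (intro mult_pos_pos) auto
    have "cmod (G z) / (exp (Im z) * cmod (1 + z) powr \<alpha>) \<le> K"
      using \<open>cmod (h z) \<le> K\<close> unfolding norm_h by (simp add: powr_minus exp_minus field_simps)
    then show ?thesis using pos_divide_le_eq[OF pos] by (simp add: mult_ac)
  qed
  also have "\<dots> \<le> K * (1 + cmod z) powr \<alpha> * exp (Im z)"
    using \<open>0 < K\<close> \<open>0 \<le> \<alpha>\<close> norm_triangle_ineq[of 1 z]
    by (intro mult_right_mono mult_left_mono powr_mono2) auto
  finally show ?thesis .
qed

text \<open>The remaining quadrants are reached by the reflections \<open>z \<mapsto> - z\<close> and \<open>z \<mapsto> - cnj z\<close>, the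
  latter combined with conjugation of the values.\<close>

lemma exponential_type_bound:
  assumes holo: "G holomorphic_on UNIV"
    and type: "\<And>z. cmod (G z) \<le> M * exp (cmod z)"
    and re: "\<And>x. cmod (G (of_real x)) \<le> K * (1 + \<bar>x\<bar>) powr \<alpha>"
    and "0 \<le> \<alpha>" "0 < K" "M \<le> K"
  shows "cmod (G z) \<le> K * (1 + cmod z) powr \<alpha> * exp \<bar>Im z\<bar>"
proof -
  note quadrant = exponential_type_in_quadrant[where M = M and K = K and \<alpha> = \<alpha>, OF _ _ _ \<open>0 \<le> \<alpha>\<close> \<open>0 < K\<close> \<open>M \<le> K\<close>]
  have upper: "cmod (H z) \<le> K * (1 + cmod z) powr \<alpha> * exp (Im z)"
    if H: "H holomorphic_on UNIV" "\<And>z. cmod (H z) \<le> M * exp (cmod z)"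
      "\<And>x. cmod (H (of_real x)) \<le> K * (1 + \<bar>x\<bar>) powr \<alpha>" and "0 \<le> Im z" for H z
  proof (cases "0 \<le> Re z")
    case True
    have "cmod (H (of_real x)) \<le> K * (1 + x) powr \<alpha>" if "0 \<le> x" for x
      using H(3)[of x] that by simp
    then show ?thesis by (rule quadrant[OF H(1,2) _ True \<open>0 \<le> Im z\<close>])
  next
    case False
    define H' where "H' = cnj \<circ> (\<lambda>z. H (- z)) \<circ> cnj"
    have "H' holomorphic_on UNIV"
      unfolding H'_def using holomorphic_on_reflect[OF H(1)]
      by (intro holomorphic_on_compose_cnj_cnj) (auto intro: holomorphic_on_subset)
    moreover have "cmod (H' z) \<le> M * exp (cmod z)" for z
      using H(2)[of "- cnj z"] by (simp add: H'_def)
    moreover have "cmod (H' (of_real x)) \<le> K * (1 + x) powr \<alpha>" if "0 \<le> x" for x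
      using H(3)[of "- x"] that by (simp add: H'_def)
    ultimately have "cmod (H' (- cnj z)) \<le> K * (1 + cmod (- cnj z)) powr \<alpha> * exp (Im (- cnj z))"
      by (rule quadrant[where G = H']) (use False \<open>0 \<le> Im z\<close> in auto)
    then show ?thesis by (simp add: H'_def)
  qed
  show ?thesis
  proof (cases "0 \<le> Im z")
    case True
    then show ?thesis using upper[OF holo type re True] by simp
  next
    case False
    note holomorphic_on_reflect[OF holo]
    moreover have "cmod (G (- z)) \<le> M * exp (cmod z)" for z
      using type[of "- z"] by simp
    moreover have "cmod (G (- of_real x)) \<le> K * (1 + \<bar>x\<bar>) powr \<alpha>" for x
      using re[of "- x"] by simp
    ultimately have "cmod (G (- (- z))) \<le> K * (1 + cmod (- z)) powr \<alpha> * exp (Im (- z))"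
      by (rule upper[where H = "\<lambda>z. G (- z)"]) (use False in simp)
    then show ?thesis using False by simp
  qed
qed

section \<open>The interpolation formula of M. Riesz\<close>

lemma contour_integral_rectpath_bound:
  assumes cont: "continuous_on (path_image (rectpath a b)) f"
    and le: "Re a \<le> Re b" "Im a \<le> Im b"
    and B: "\<And>z. z \<in> path_image (rectpath a b) \<Longrightarrow> cmod (f z) \<le> B"
  shows "cmod (contour_integral (rectpath a b) f) \<le> B * (2 * (Re b - Re a) + 2 * (Im b - Im a))"
proof -
  define c d where "c = Complex (Re b) (Im a)" and "d = Complex (Re a) (Im b)"
  have rp: "rectpath a b = linepath a c +++ linepath c b +++ linepath b d +++ linepath d a"
    by (simp add: rectpath_def c_def d_def Let_def)
  have img: "path_image (rectpath a b) =
      closed_segment a c \<union> closed_segment c b \<union> closed_segment b d \<union> closed_segment d a"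
    unfolding rp by (simp add: path_image_join Un_assoc)
  have "a \<in> path_image (rectpath a b)" unfolding img by simp
  then have "0 \<le> B" using B norm_ge_zero order_trans by blast
  have integrable: "f contour_integrable_on linepath p q"
    and bound: "cmod (contour_integral (linepath p q) f) \<le> B * cmod (q - p)"
    if "closed_segment p q \<subseteq> path_image (rectpath a b)" for p q
  proof -
    show "f contour_integrable_on linepath p q"
      by (rule contour_integrable_continuous_linepath[OF continuous_on_subset[OF cont that]])
    then show "cmod (contour_integral (linepath p q) f) \<le> B * cmod (q - p)"
      by (rule contour_integral_bound_linepath) (use \<open>0 \<le> B\<close> B that in auto)
  qed
  let ?I = "\<lambda>p q. contour_integral (linepath p q) f"
  have sides: "closed_segment a c \<subseteq> path_image (rectpath a b)" "closed_segment c b \<subseteq> path_image (rectpath a b)"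
    "closed_segment b d \<subseteq> path_image (rectpath a b)" "closed_segment d a \<subseteq> path_image (rectpath a b)"
    unfolding img by auto
  have split: "contour_integral (rectpath a b) f = ?I a c + (?I c b + (?I b d + ?I d a))"
    unfolding rp using integrable[OF sides(1)] integrable[OF sides(2)] integrable[OF sides(3)]
      integrable[OF sides(4)] by (simp add: contour_integrable_join)
  have "cmod (contour_integral (rectpath a b) f) \<le> cmod (?I a c) + (cmod (?I c b) + (cmod (?I b d) + cmod (?I d a)))"
    unfolding split by (intro order_trans[OF norm_triangle_ineq] add_left_mono order_refl)
  also have "\<dots> \<le> B * cmod (c - a) + (B * cmod (b - c) + (B * cmod (d - b) + B * cmod (a - d)))"
    by (rule add_mono[OF bound[OF sides(1)] add_mono[OF bound[OF sides(2)]
          add_mono[OF bound[OF sides(3)] bound[OF sides(4)]]]])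
  also have "\<dots> = B * (2 * (Re b - Re a) + 2 * (Im b - Im a))"
  proof -
    have "c - a = of_real (Re b - Re a)" "b - c = of_real (Im b - Im a) * \<i>"
      "d - b = - of_real (Re b - Re a)" "a - d = - (of_real (Im b - Im a) * \<i>)"
      by (simp_all add: complex_eq_iff c_def d_def)
    then have "cmod (c - a) = Re b - Re a" "cmod (b - c) = Im b - Im a"
      "cmod (d - b) = Re b - Re a" "cmod (a - d) = Im b - Im a"
      using le by (simp_all only: norm_minus_cancel norm_mult norm_of_real norm_ii) simp_all
    then show ?thesis by (simp only: distrib_left mult_2 add_ac)
  qed
  finally show ?thesis .
qed

text \<open>The zeros of the cosine, which are the nodes of the interpolation formula.\<close>

definition node :: "int \<Rightarrow> real"
  where "node k = (2 * of_int k + 1) * pi / 2"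

lemma abs_node: "\<bar>node k\<bar> = \<bar>2 * of_int k + 1\<bar> * (pi / 2)"
  by (simp add: node_def abs_mult)

lemma abs_odd_ge_one: "1 \<le> \<bar>2 * real_of_int k + 1\<bar>"
proof -
  have "1 \<le> \<bar>2 * k + 1\<bar>" by presburger
  then show ?thesis by linarith
qed

lemma abs_node_ge_one: "1 \<le> \<bar>node k\<bar>"
  using mult_mono[OF abs_odd_ge_one[of k], of 1 "pi / 2"] pi_gt3 by (simp add: abs_node)

lemma node_nonzero: "node k \<noteq> 0"
  using abs_node_ge_one[of k] by auto

lemma cos_node: "cos (node k) = 0"
  unfolding cos_zero_iff_int2 by (intro exI[of _ k]) (simp add: node_def field_simps)

lemma sin_node_squared: "(sin (node k))\<^sup>2 = 1"
  using sin_cos_squared_add[of "node k"] by (simp add: cos_node)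

lemma cos_complex_eq_0_iff_node: "cos z = 0 \<longleftrightarrow> (\<exists>k. z = complex_of_real (node k))"
  unfolding cos_eq_0 by (simp add: node_def field_simps)

lemma node_less_iff: "\<bar>node k\<bar> < real n * pi \<longleftrightarrow> k \<in> {- int n..<int n}"
proof -
  have "\<bar>node k\<bar> < real n * pi \<longleftrightarrow> \<bar>2 * of_int k + 1\<bar> * (pi / 2) < (2 * real n) * (pi / 2)"
    by (simp only: abs_node) simp
  also have "\<dots> \<longleftrightarrow> \<bar>2 * of_int k + 1\<bar> < 2 * real n"
    by (rule mult_less_cancel_right_pos) simp
  also have "\<dots> \<longleftrightarrow> \<bar>2 * k + 1\<bar> < 2 * int n"
    by linarith
  also have "\<dots> \<longleftrightarrow> k \<in> {- int n..<int n}" by auto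
  finally show ?thesis .
qed

text \<open>On the boundary of the squares with half side \<open>n * pi\<close> the cosine stays away from its
  zeros: on the vertical sides it equals \<open>cosh (Im z)\<close> up to sign, and on the horizontal sides it is
  at least \<open>sinh \<bar>Im z\<bar>\<close> in modulus.\<close>

lemma cmod_cos_ge_on_square:
  assumes "\<bar>Re z\<bar> = real n * pi \<or> \<bar>Im z\<bar> = real n * pi" and "0 < n"
  shows "exp \<bar>Im z\<bar> / 4 \<le> cmod (cos z)"
proof (rule power2_le_imp_le)
  define E where "E = exp \<bar>Im z\<bar>"
  have E: "1 \<le> E" by (simp add: E_def)
  have sq: "(exp (Im z) - inverse (exp (Im z)))\<^sup>2 = E\<^sup>2 - 2 + (inverse E)\<^sup>2"
    by (cases "0 \<le> Im z") (simp_all add: E_def exp_minus power2_eq_square algebra_simps)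
  have norm: "(cmod (cos z))\<^sup>2 = (cos (Re z))\<^sup>2 + (E\<^sup>2 - 2 + (inverse E)\<^sup>2) / 4"
    using norm_cos_squared[of z] sq by simp
  have "E\<^sup>2 / 16 \<le> (cmod (cos z))\<^sup>2"
    using assms(1)
  proof
    assume "\<bar>Re z\<bar> = real n * pi"
    then have "cos (Re z) = (-1) ^ n" by (metis abs_of_nonneg abs_of_nonpos cos_abs_real cos_npi)
    then have "(cos (Re z))\<^sup>2 = 1" by (simp flip: power_mult)
    then show ?thesis using norm zero_le_power2[of E] zero_le_power2[of "inverse E"] by argo
  next
    assume "\<bar>Im z\<bar> = real n * pi"
    moreover have "1 * pi \<le> real n * pi" using \<open>0 < n\<close> by (intro mult_right_mono) auto
    ultimately have "4 \<le> E" using exp_ge_add_one_self[of "\<bar>Im z\<bar>"] pi_gt3 unfolding E_def by linarith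
    then have "4\<^sup>2 \<le> E\<^sup>2" by (intro power_mono) auto
    then have "16 \<le> E\<^sup>2" by simp
    then show ?thesis using norm zero_le_power2[of "cos (Re z)"] zero_le_power2[of "inverse E"] by argo
  qed
  then show "(exp \<bar>Im z\<bar> / 4)\<^sup>2 \<le> (cmod (cos z))\<^sup>2" by (simp add: E_def power_divide)
qed simp

text \<open>The factor \<open>sin (node k)\<close> is a sign, hence equal to its own inverse; writing it in the
  numerator lets the formula be tested on the sine itself later.\<close>

lemma residue_interpolation_node:
  assumes "G holomorphic_on UNIV"
  shows "residue (\<lambda>z. G z / (z\<^sup>2 * cos z)) (of_real (node k)) =
    - (of_real (sin (node k)) * G (of_real (node k)) / (of_real (node k))\<^sup>2)"
proof -
  let ?t = "of_real (node k) :: complex"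
  let ?U = "ball ?t (min \<bar>node k\<bar> 1)"
  have U: "open ?U" "?t \<in> ?U" using node_nonzero by auto
  have notin: "0 \<notin> ?U" by (simp add: dist_norm)
  have cosU: "cos z \<noteq> 0" if "z \<in> ?U - {?t}" for z
  proof
    assume "cos z = 0"
    then obtain j where z: "z = of_real (node j)" by (auto simp: cos_complex_eq_0_iff_node)
    then have "\<bar>node k - node j\<bar> < 1"
      using that by (simp add: dist_norm norm_minus_commute flip: of_real_diff)
    moreover have "node k - node j = of_int (k - j) * pi" by (simp add: node_def field_simps)
    ultimately have "real_of_int \<bar>k - j\<bar> * pi < 1" by (simp add: abs_mult)
    moreover have "j \<noteq> k" using z that by auto
    then have "1 * 1 \<le> real_of_int \<bar>k - j\<bar> * pi"
      using pi_gt3 by (intro mult_mono) auto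
    ultimately show False by simp
  qed
  have sin1: "sin (node k) * sin (node k) = 1" using sin_node_squared[of k] by (simp add: power2_eq_square)
  show ?thesis
  proof (rule residue_simple'[OF U])
    show "(\<lambda>z. G z / (z\<^sup>2 * cos z)) holomorphic_on ?U - {?t}"
      using notin cosU by (intro holomorphic_intros holomorphic_on_subset[OF assms]) auto
    have "((cos :: complex \<Rightarrow> complex) has_field_derivative - sin ?t) (at ?t)"
      by (rule DERIV_cos)
    then have "((\<lambda>z. (cos z - cos ?t) / (z - ?t)) \<longlongrightarrow> - sin ?t) (at ?t)"
      by (simp add: has_field_derivative_iff)
    moreover have "cos ?t = 0" by (auto simp: cos_complex_eq_0_iff_node)
    ultimately have "((\<lambda>z. cos z / (z - ?t)) \<longlongrightarrow> - sin ?t) (at ?t)"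
      by simp
    moreover have "G \<midarrow>?t\<rightarrow> G ?t"
      using assms by (metis UNIV_I continuous_on_eq_continuous_at holomorphic_on_imp_continuous_on isContD open_UNIV)
    moreover have "sin ?t \<noteq> 0" using sin1 by (metis mult_zero_left of_real_eq_0_iff sin_of_real zero_neq_one)
    ultimately have "((\<lambda>z. (G z / z\<^sup>2) / (cos z / (z - ?t))) \<longlongrightarrow> (G ?t / ?t\<^sup>2) / (- sin ?t)) (at ?t)"
      using node_nonzero by (intro tendsto_intros) auto
    moreover have "(G ?t / ?t\<^sup>2) / (- sin ?t) = - (of_real (sin (node k)) * G ?t / ?t\<^sup>2)"
    proof -
      have "inverse (sin (node k)) = sin (node k)" using sin1 by (rule inverse_unique)
      then have "inverse (sin ?t) = of_real (sin (node k))"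
        by (simp add: sin_of_real flip: of_real_inverse)
      then show ?thesis by (simp add: divide_inverse mult_ac)
    qed
    ultimately show "((\<lambda>z. G z / (z\<^sup>2 * cos z) * (z - ?t)) \<longlongrightarrow> - (of_real (sin (node k)) * G ?t / ?t\<^sup>2)) (at ?t)"
      by (simp add: field_simps)
  qed
qed

text \<open>The derivative of \<open>1 / cos\<close> vanishes at \<open>0\<close>, so only that of \<open>G\<close> survives.\<close>

lemma residue_interpolation_zero:
  assumes "G holomorphic_on UNIV"
  shows "residue (\<lambda>z. G z / (z\<^sup>2 * cos z)) 0 = deriv G 0"
proof -
  have nz: "cos z \<noteq> 0" if "z \<in> ball 0 1" for z :: complex
  proof
    assume "cos z = 0"
    then obtain k where z: "z = of_real (node k)" by (auto simp: cos_complex_eq_0_iff_node)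
    then show False using that abs_node_ge_one[of k] by simp
  qed
  have "(\<lambda>z. G z / cos z) holomorphic_on ball 0 1"
    using nz by (intro holomorphic_intros holomorphic_on_subset[OF assms]) auto
  from residue_holomorphic_over_power'[OF open_ball _ this, of 1]
  have "residue (\<lambda>z. G z / cos z / z ^ 2) 0 = deriv (\<lambda>z. G z / cos z) 0"
    by (simp add: numeral_2_eq_2)
  moreover have "((\<lambda>z. G z / cos z) has_field_derivative deriv G 0) (at 0)"
    using assms by (auto intro!: derivative_eq_intros holomorphic_derivI[of G UNIV])
  ultimately show ?thesis by (simp add: DERIV_imp_deriv mult.commute)
qed

text \<open>The interpolation formula of M. Riesz for the derivative of a function of exponential type
  one, by integrating \<open>G z / (z\<^sup>2 * cos z)\<close> over the squares with half side \<open>n * pi\<close>. The lower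
  bound for the cosine absorbs the exponential factor. What remains is of order
  \<open>n\<close> to the power \<open>\<alpha> - 2\<close> on a path of length proportional to \<open>n\<close>, which tends to \<open>0\<close>
  because \<open>\<alpha> < 1\<close>.\<close>

theorem riesz_interpolation:
  assumes holo: "G holomorphic_on UNIV"
    and bound: "\<And>z. cmod (G z) \<le> K * (1 + cmod z) powr \<alpha> * exp \<bar>Im z\<bar>"
    and "0 \<le> \<alpha>" "\<alpha> < 1"
  shows "(\<lambda>n. \<Sum>k\<in>{- int n..<int n}. of_real (sin (node k)) * G (of_real (node k)) / (of_real (node k))\<^sup>2)
    \<longlonglongrightarrow> deriv G 0"
proof -
  let ?a = "\<lambda>k. of_real (sin (node k)) * G (of_real (node k)) / (of_real (node k))\<^sup>2"
  define f where "f z = G z / (z\<^sup>2 * cos z)" for z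
  have "0 \<le> K" using order_trans[OF norm_ge_zero bound[of 0]] by simp
  have est: "cmod (deriv G 0 - (\<Sum>k\<in>{- int n..<int n}. ?a k)) \<le>
      16 / pi * K * ((1 + 2 * (real n * pi)) powr \<alpha> / (real n * pi))" if "0 < n" for n
  proof -
    define R where "R = real n * pi"
    have R: "pi \<le> R" using that by (simp add: R_def)
    then have "0 < R" using pi_gt_zero by linarith
    define a b where "a = Complex (- R) (- R)" and "b = Complex R R"
    define P where "P = complex_of_real ` node ` {- int n..<int n}"
    \<comment> \<open>A strip containing the square and, since consecutive nodes are \<open>pi\<close> apart, no further pole.\<close>
    define S where "S = {z. \<bar>Re z\<bar> < R + pi / 2}"
    have Pin: "\<bar>Re p\<bar> < R \<and> Im p = 0" if "p \<in> P" for p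
      using that by (auto simp: P_def R_def node_less_iff)
    have P0: "0 \<notin> P" using node_nonzero by (auto simp: P_def)
    have edge: "(\<bar>Re z\<bar> = R \<or> \<bar>Im z\<bar> = R) \<and> \<bar>Re z\<bar> \<le> R \<and> \<bar>Im z\<bar> \<le> R"
      if "z \<in> path_image (rectpath a b)" for z
      using that \<open>0 < R\<close> by (auto simp: path_image_rectpath a_def b_def)
    have nonzero: "z\<^sup>2 * cos z \<noteq> 0" if "z \<in> S - insert 0 P" for z
    proof
      assume "z\<^sup>2 * cos z = 0"
      then have "cos z = 0" using that by auto
      then obtain k where z: "z = of_real (node k)" by (auto simp: cos_complex_eq_0_iff_node)
      then have "\<bar>node k\<bar> < R + pi / 2" using that by (simp add: S_def)
      then have "\<bar>2 * of_int k + 1\<bar> * (pi / 2) < (2 * real n + 1) * (pi / 2)"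
        by (simp only: abs_node R_def) (simp add: algebra_simps)
      then have "\<bar>2 * of_int k + 1\<bar> < 2 * real n + 1"
        by (rule mult_right_less_imp_less) simp
      then have "\<bar>2 * k + 1\<bar> < 2 * int n + 1" by linarith
      then have "k \<in> {- int n..<int n}" by auto
      then show False using that z by (auto simp: P_def)
    qed
    have "open S" "convex S"
    proof -
      have S: "S = {z. Re z < R + pi / 2} \<inter> {z. Re z > - (R + pi / 2)}" by (auto simp: S_def)
      show "open S" unfolding S by (intro open_Int open_halfspace_Re_lt open_halfspace_Re_gt)
      show "convex S" unfolding S by (intro convex_Int convex_halfspace_Re_lt convex_halfspace_Re_gt)
    qed
    have sub: "path_image (rectpath a b) \<subseteq> S - insert 0 P"
    proof
      fix z assume "z \<in> path_image (rectpath a b)"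
      note z = edge[OF this]
      have "\<bar>Re z\<bar> < R + pi / 2" using z pi_gt_zero by linarith
      then show "z \<in> S - insert 0 P"
        using z Pin[of z] \<open>0 < R\<close> by (auto simp: S_def)
    qed
    have fholo: "f holomorphic_on S - insert 0 P"
      unfolding f_def using nonzero by (intro holomorphic_intros holomorphic_on_subset[OF holo]) auto
    have "contour_integral (rectpath a b) f =
        2 * pi * \<i> * (\<Sum>p\<in>insert 0 P. winding_number (rectpath a b) p * residue f p)"
    proof (rule Residue_theorem[OF \<open>open S\<close> convex_connected[OF \<open>convex S\<close>] _ fholo _ _ sub])
      show "finite (insert 0 P)" by (simp add: P_def)
      show "\<forall>z. z \<notin> S \<longrightarrow> winding_number (rectpath a b) z = 0"
      proof (intro allI impI winding_number_rectpath_outside)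
        fix z assume "z \<notin> S"
        show "z \<notin> cbox a b"
        proof
          assume "z \<in> cbox a b"
          then have "\<bar>Re z\<bar> \<le> R" by (auto simp: a_def b_def in_cbox_complex_iff)
          then have "\<bar>Re z\<bar> < R + pi / 2" using pi_gt_zero by linarith
          then show False using \<open>z \<notin> S\<close> by (simp add: S_def)
        qed
      qed (use \<open>0 < R\<close> in \<open>auto simp: a_def b_def\<close>)
    qed auto
    also have "(\<Sum>p\<in>insert 0 P. winding_number (rectpath a b) p * residue f p) = (\<Sum>p\<in>insert 0 P. residue f p)"
    proof (rule sum.cong)
      fix p assume "p \<in> insert 0 P"
      then have "\<bar>Re p\<bar> < R \<and> Im p = 0" using Pin \<open>0 < R\<close> by auto
      then have "winding_number (rectpath a b) p = 1"
        using \<open>0 < R\<close> by (intro winding_number_rectpath) (auto simp: a_def b_def in_box_complex_iff)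
      then show "winding_number (rectpath a b) p * residue f p = residue f p" by simp
    qed simp
    also have "\<dots> = residue f 0 + (\<Sum>p\<in>P. residue f p)"
      using P0 by (simp add: P_def)
    also have "residue f 0 = deriv G 0"
      unfolding f_def by (rule residue_interpolation_zero[OF holo])
    also have "(\<Sum>p\<in>P. residue f p) = (\<Sum>k\<in>{- int n..<int n}. residue f (of_real (node k)))"
    proof -
      have "inj_on (\<lambda>k. complex_of_real (node k)) {- int n..<int n}"
        by (rule inj_onI) (simp add: node_def)
      then show ?thesis unfolding P_def image_image by (simp add: sum.reindex)
    qed
    also have "\<dots> = - (\<Sum>k\<in>{- int n..<int n}. ?a k)"
      unfolding f_def residue_interpolation_node[OF holo] by (simp add: sum_negf)
    finally have eq: "contour_integral (rectpath a b) f =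
        2 * pi * \<i> * (deriv G 0 - (\<Sum>k\<in>{- int n..<int n}. ?a k))" by simp
    have fbound: "cmod (f z) \<le> 4 * K * (1 + 2 * R) powr \<alpha> / R\<^sup>2" if z: "z \<in> path_image (rectpath a b)" for z
    proof -
      have "R \<le> cmod z" using edge[OF z] abs_Re_le_cmod[of z] abs_Im_le_cmod[of z] by auto
      have "cmod z \<le> 2 * R" using edge[OF z] cmod_le[of z] by linarith
      have "cmod (G z) \<le> K * (1 + cmod z) powr \<alpha> * exp \<bar>Im z\<bar>" by (rule bound)
      also have "\<dots> \<le> K * (1 + 2 * R) powr \<alpha> * exp \<bar>Im z\<bar>"
        using \<open>cmod z \<le> 2 * R\<close> \<open>0 \<le> K\<close> \<open>0 \<le> \<alpha>\<close>
        by (intro mult_right_mono mult_left_mono powr_mono2) auto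
      finally have num: "cmod (G z) \<le> K * (1 + 2 * R) powr \<alpha> * exp \<bar>Im z\<bar>" .
      have "R\<^sup>2 * (exp \<bar>Im z\<bar> / 4) \<le> (cmod z)\<^sup>2 * cmod (cos z)"
        using \<open>R \<le> cmod z\<close> \<open>0 < R\<close> edge[OF z] that cmod_cos_ge_on_square[of z n] \<open>0 < n\<close>
        by (intro mult_mono power_mono) (auto simp: R_def)
      then have "cmod (f z) \<le> (K * (1 + 2 * R) powr \<alpha> * exp \<bar>Im z\<bar>) / (R\<^sup>2 * (exp \<bar>Im z\<bar> / 4))"
        unfolding f_def norm_divide norm_mult norm_power using num \<open>0 < R\<close> \<open>0 \<le> K\<close>
        by (intro frac_le) auto
      then show ?thesis by (simp add: mult_ac)
    qed
    have "cmod (contour_integral (rectpath a b) f) \<le>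
        4 * K * (1 + 2 * R) powr \<alpha> / R\<^sup>2 * (2 * (Re b - Re a) + 2 * (Im b - Im a))"
    proof (rule contour_integral_rectpath_bound)
      show "continuous_on (path_image (rectpath a b)) f"
        by (rule continuous_on_subset[OF holomorphic_on_imp_continuous_on[OF fholo] sub])
    qed (use \<open>0 < R\<close> fbound in \<open>auto simp: a_def b_def\<close>)
    also have "\<dots> = 2 * pi * (16 / pi * K * ((1 + 2 * R) powr \<alpha> / R))"
      using \<open>0 < R\<close> by (simp add: a_def b_def power2_eq_square field_simps)
    finally have "2 * pi * cmod (deriv G 0 - (\<Sum>k\<in>{- int n..<int n}. ?a k))
        \<le> 2 * pi * (16 / pi * K * ((1 + 2 * R) powr \<alpha> / R))"
      unfolding eq by (simp only: norm_mult norm_ii norm_of_real mult_1_right abs_mult abs_numeral abs_of_pos[OF pi_gt_zero])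
    then show ?thesis
      unfolding R_def by (rule mult_left_le_imp_le) simp
  qed
  have "(\<lambda>n. (1 + 2 * (real n * pi)) powr \<alpha> / (real n * pi)) \<longlonglongrightarrow> 0"
    using \<open>\<alpha> < 1\<close> \<open>0 \<le> \<alpha>\<close> by real_asymp
  then have "(\<lambda>n. 16 / pi * K * ((1 + 2 * (real n * pi)) powr \<alpha> / (real n * pi))) \<longlonglongrightarrow> 0"
    by (rule tendsto_mult_right_zero)
  then have "(\<lambda>n. deriv G 0 - (\<Sum>k\<in>{- int n..<int n}. ?a k)) \<longlonglongrightarrow> 0"
    by (rule Lim_null_comparison[rotated]) (use est in \<open>auto intro!: eventually_sequentiallyI[of 1]\<close>)
  from tendsto_diff[OF tendsto_const[of "deriv G 0"] this] show ?thesis by simp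
qed

section \<open>Bernstein's inequality under a growth condition\<close>

lemma abs_pow_eq_powr: "t \<noteq> 0 \<Longrightarrow> abs_pow t \<alpha> = \<bar>t\<bar> powr \<alpha>"
  by (simp add: abs_pow_def)

lemma one_plus_abs_pow_le:
  assumes "0 \<le> \<alpha>"
  shows "1 + abs_pow t \<alpha> \<le> 2 * (1 + \<bar>t\<bar>) powr \<alpha>"
proof -
  have "\<bar>t\<bar> powr \<alpha> \<le> (1 + \<bar>t\<bar>) powr \<alpha>" "1 \<le> (1 + \<bar>t\<bar>) powr \<alpha>"
    using assms by (auto intro: powr_mono2 ge_one_powr_ge_zero)
  then show ?thesis by (auto simp: abs_pow_def)
qed

text \<open>The nonnegative integers and the negative ones \<open>- n - 1\<close> run through the same odd
  numbers \<open>2 * n + 1\<close> in absolute value.\<close>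

lemma summable_on_odd_powr:
  assumes "1 < p"
  shows "(\<lambda>k. 1 / \<bar>2 * real_of_int k + 1\<bar> powr p) summable_on (UNIV :: int set)"
proof -
  let ?f = "\<lambda>k :: int. 1 / \<bar>2 * real_of_int k + 1\<bar> powr p"
  let ?g = "\<lambda>n :: nat. 1 / (2 * real n + 1) powr p"
  have "summable (\<lambda>n. real (Suc n) powr - p)"
    using assms summable_real_powr_iff[of "- p"] summable_Suc_iff[of "\<lambda>n. real n powr - p"] by simp
  moreover have "norm (?g n) \<le> real (Suc n) powr - p" for n
    using assms by (simp add: powr_minus_divide) (intro divide_left_mono powr_mono2 mult_pos_pos; simp)
  ultimately have "summable ?g"
    by (blast intro: summable_comparison_test')
  then have g: "?g summable_on UNIV"
    by (subst summable_on_UNIV_nonneg_real_iff) auto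
  have "inj int" "inj (\<lambda>n. - int n - 1)" by (auto intro: injI)
  moreover have "(?f \<circ> int) summable_on UNIV" "(?f \<circ> (\<lambda>n. - int n - 1)) summable_on UNIV"
    using g by (simp_all add: o_def abs_if add.commute)
  ultimately have "?f summable_on range int" "?f summable_on range (\<lambda>n. - int n - 1)"
    by (simp_all add: summable_on_reindex)
  then have "?f summable_on (range int \<union> range (\<lambda>n. - int n - 1))"
    by (intro summable_on_Un_disjoint) auto
  moreover have "range int \<union> range (\<lambda>n. - int n - 1) = UNIV"
  proof -
    have "k \<in> range int \<union> range (\<lambda>n. - int n - 1)" for k
    proof (cases "0 \<le> k")
      case True
      then have "k = int (nat k)" by simp
      then show ?thesis by blast
    next
      case False
      then have "k = - int (nat (- k - 1)) - 1" by simp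
      then show ?thesis by blast
    qed
    then show ?thesis by blast
  qed
  ultimately show ?thesis by simp
qed

lemma sum_node_powr_le:
  assumes "\<alpha> < 1" "finite I"
  shows "(\<Sum>k\<in>I. \<bar>node k\<bar> powr \<alpha> / (node k)\<^sup>2) \<le> C_const \<alpha>"
proof -
  have "\<bar>node k\<bar> powr \<alpha> / (node k)\<^sup>2 = (2 / pi) powr (2 - \<alpha>) * (1 / \<bar>2 * real_of_int k + 1\<bar> powr (2 - \<alpha>))" for k
  proof -
    have "(node k)\<^sup>2 = \<bar>node k\<bar> powr 2"
      using node_nonzero[of k] by simp
    then have "\<bar>node k\<bar> powr \<alpha> / (node k)\<^sup>2 = 1 / \<bar>node k\<bar> powr (2 - \<alpha>)"
      using node_nonzero[of k] by (simp add: powr_diff)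
    also have "\<dots> = (1 / (pi / 2)) powr (2 - \<alpha>) * (1 / \<bar>2 * real_of_int k + 1\<bar> powr (2 - \<alpha>))"
      by (simp only: abs_node) (simp add: powr_mult powr_divide)
    finally show ?thesis by simp
  qed
  then have "(\<Sum>k\<in>I. \<bar>node k\<bar> powr \<alpha> / (node k)\<^sup>2) =
      (2 / pi) powr (2 - \<alpha>) * (\<Sum>k\<in>I. 1 / \<bar>2 * real_of_int k + 1\<bar> powr (2 - \<alpha>))"
    by (simp only: sum_distrib_left)
  also have "\<dots> \<le> C_const \<alpha>"
    unfolding C_const_def using assms
    by (intro mult_left_mono finite_sum_le_infsum summable_on_odd_powr) auto
  finally show ?thesis .
qed

text \<open>This is the interpolation formula for the sine, whose derivative at \<open>0\<close> is \<open>1\<close>. It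
  amounts to the classical value \<open>pi\<^sup>2 / 4\<close> of the sum of the inverse squares of all odd integers.\<close>

lemma sum_inverse_node_squared: "(\<lambda>n. \<Sum>k\<in>{- int n..<int n}. 1 / (node k)\<^sup>2) \<longlonglongrightarrow> 1"
proof -
  have sin_le: "cmod (sin z) \<le> 1 * (1 + cmod z) powr 0 * exp \<bar>Im z\<bar>" for z
    using cmod_sin_le_exp[of 1 z] by (simp add: add_nonneg_eq_0_iff)
  have "(\<lambda>n. \<Sum>k\<in>{- int n..<int n}. of_real (sin (node k)) * sin (of_real (node k)) / (of_real (node k))\<^sup>2)
      \<longlonglongrightarrow> deriv sin (0 :: complex)"
    by (rule riesz_interpolation[OF _ sin_le]) (auto intro: holomorphic_intros)
  moreover have "deriv sin (0 :: complex) = of_real 1"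
    by (rule DERIV_imp_deriv) (auto intro!: derivative_eq_intros)
  moreover have "of_real (sin (node k)) * sin (of_real (node k)) / (of_real (node k))\<^sup>2
      = complex_of_real (1 / (node k)\<^sup>2)" for k
    using sin_node_squared[of k] by (simp add: sin_of_real power2_eq_square flip: of_real_mult)
  ultimately have "(\<lambda>n. complex_of_real (\<Sum>k\<in>{- int n..<int n}. 1 / (node k)\<^sup>2)) \<longlonglongrightarrow> of_real 1"
    by (simp only: of_real_sum)
  then show ?thesis by (simp only: tendsto_of_real_iff)
qed

text \<open>Bernstein's inequality at the origin for functions of exponential type \<open>\<sigma>\<close> that may grow on
  the real line. After rescaling to type one, the triangle inequality is applied to the
  interpolation formula: the constant part of the growth condition meets the sum of the inverse
  squares of the nodes, and the part \<open>\<bar>t\<bar>\<close> to the power \<open>\<alpha>\<close> meets the sum that defines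
  \<^const>\<open>C_const\<close>.\<close>

theorem bernstein_inequality_growth:
  assumes holo: "F holomorphic_on UNIV"
    and type: "\<And>z. cmod (F z) \<le> M * exp (\<sigma> * cmod z)"
    and re: "\<And>t. cmod (F (of_real t)) \<le> C * (1 + abs_pow t \<alpha>)"
    and "0 < \<sigma>" "0 \<le> \<alpha>" "\<alpha> < 1" "0 < C"
  shows "cmod (deriv F 0) \<le> C * (\<sigma> + C_const \<alpha> * \<sigma> powr (1 - \<alpha>))"
proof -
  define G where "G z = F (z / of_real \<sigma>)" for z
  have scale: "(\<lambda>z. z / of_real \<sigma>) holomorphic_on UNIV"
    using \<open>0 < \<sigma>\<close> by (intro holomorphic_intros) auto
  have G_holo: "G holomorphic_on UNIV"
    using holomorphic_on_compose_gen[OF scale holo] by (simp add: G_def[abs_def] o_def)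
  have G_type: "cmod (G z) \<le> M * exp (cmod z)" for z
    using type[of "z / of_real \<sigma>"] \<open>0 < \<sigma>\<close> by (simp add: G_def norm_divide)
  define s where "s = max 1 (1 / \<sigma>)"
  have s: "1 \<le> s" "1 / \<sigma> \<le> s" by (simp_all add: s_def)
  have G_re: "cmod (G (of_real x)) \<le> max (2 * C * s powr \<alpha>) M * (1 + \<bar>x\<bar>) powr \<alpha>" for x
  proof -
    have "1 + \<bar>x / \<sigma>\<bar> \<le> s * (1 + \<bar>x\<bar>)"
    proof -
      have "1 / \<sigma> * \<bar>x\<bar> \<le> s * \<bar>x\<bar>" by (intro mult_right_mono s) simp
      then show ?thesis using s(1) \<open>0 < \<sigma>\<close> by (simp add: distrib_left)
    qed
    then have "(1 + \<bar>x / \<sigma>\<bar>) powr \<alpha> \<le> (s * (1 + \<bar>x\<bar>)) powr \<alpha>"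
      using \<open>0 \<le> \<alpha>\<close> by (intro powr_mono2) auto
    also have "\<dots> = s powr \<alpha> * (1 + \<bar>x\<bar>) powr \<alpha>" using s(1) by (simp add: powr_mult)
    finally have "C * (2 * (1 + \<bar>x / \<sigma>\<bar>) powr \<alpha>) \<le> C * (2 * (s powr \<alpha> * (1 + \<bar>x\<bar>) powr \<alpha>))"
      using \<open>0 < C\<close> by simp
    moreover have "cmod (F (of_real (x / \<sigma>))) \<le> C * (2 * (1 + \<bar>x / \<sigma>\<bar>) powr \<alpha>)"
      using order_trans[OF re[of "x / \<sigma>"] mult_left_mono[OF one_plus_abs_pow_le]] \<open>0 \<le> \<alpha>\<close> \<open>0 < C\<close> by simp
    ultimately have "cmod (G (of_real x)) \<le> (2 * C * s powr \<alpha>) * (1 + \<bar>x\<bar>) powr \<alpha>"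
      by (simp add: G_def mult_ac)
    also have "\<dots> \<le> max (2 * C * s powr \<alpha>) M * (1 + \<bar>x\<bar>) powr \<alpha>"
      by (intro mult_right_mono) auto
    finally show ?thesis .
  qed
  have "cmod (G z) \<le> max (2 * C * s powr \<alpha>) M * (1 + cmod z) powr \<alpha> * exp \<bar>Im z\<bar>" for z
  proof (rule exponential_type_bound[OF G_holo G_type G_re])
    have "0 < 2 * C * s powr \<alpha>" using \<open>0 < C\<close> s(1) by simp
    then show "0 < max (2 * C * s powr \<alpha>) M" by linarith
  qed (use \<open>0 \<le> \<alpha>\<close> in auto)
  then have "(\<lambda>n. \<Sum>k\<in>{- int n..<int n}. of_real (sin (node k)) * G (of_real (node k)) / (of_real (node k))\<^sup>2)
      \<longlonglongrightarrow> deriv G 0"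
    by (rule riesz_interpolation[OF G_holo _ \<open>0 \<le> \<alpha>\<close> \<open>\<alpha> < 1\<close>])
  then have lim: "(\<lambda>n. cmod (\<Sum>k\<in>{- int n..<int n}. of_real (sin (node k)) * G (of_real (node k)) / (of_real (node k))\<^sup>2))
      \<longlonglongrightarrow> cmod (deriv G 0)"
    by (rule tendsto_norm)
  have lim_bound: "(\<lambda>n. C * (\<Sum>k\<in>{- int n..<int n}. 1 / (node k)\<^sup>2) + C * (\<sigma> powr (- \<alpha>) * C_const \<alpha>))
      \<longlonglongrightarrow> C * 1 + C * (\<sigma> powr (- \<alpha>) * C_const \<alpha>)"
    by (intro tendsto_intros sum_inverse_node_squared)
  have partial: "cmod (\<Sum>k\<in>I. of_real (sin (node k)) * G (of_real (node k)) / (of_real (node k))\<^sup>2)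
      \<le> C * (\<Sum>k\<in>I. 1 / (node k)\<^sup>2) + C * (\<sigma> powr (- \<alpha>) * C_const \<alpha>)" if "finite I" for I
  proof -
    have summand: "cmod (of_real (sin (node k)) * G (of_real (node k)) / (of_real (node k))\<^sup>2)
        \<le> C * (1 / (node k)\<^sup>2) + C * (\<sigma> powr (- \<alpha>) * (\<bar>node k\<bar> powr \<alpha> / (node k)\<^sup>2))" for k
    proof -
      have "cmod (G (of_real (node k))) \<le> C * (1 + \<bar>node k / \<sigma>\<bar> powr \<alpha>)"
        using re[of "node k / \<sigma>"] node_nonzero[of k] \<open>0 < \<sigma>\<close>
        by (simp add: G_def abs_pow_eq_powr)
      also have "\<bar>node k / \<sigma>\<bar> powr \<alpha> = \<sigma> powr (- \<alpha>) * \<bar>node k\<bar> powr \<alpha>"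
        using \<open>0 < \<sigma>\<close> by (simp add: powr_divide powr_minus_divide)
      finally have "\<bar>sin (node k)\<bar> * cmod (G (of_real (node k))) \<le> 1 * (C * (1 + \<sigma> powr (- \<alpha>) * \<bar>node k\<bar> powr \<alpha>))"
        by (intro mult_mono) auto
      then have "\<bar>sin (node k)\<bar> * cmod (G (of_real (node k))) / (node k)\<^sup>2
          \<le> C * (1 + \<sigma> powr (- \<alpha>) * \<bar>node k\<bar> powr \<alpha>) / (node k)\<^sup>2"
        by (intro divide_right_mono) auto
      then show ?thesis
        by (simp add: norm_mult norm_divide norm_power add_divide_distrib distrib_left)
    qed
    have "cmod (\<Sum>k\<in>I. of_real (sin (node k)) * G (of_real (node k)) / (of_real (node k))\<^sup>2)
        \<le> (\<Sum>k\<in>I. C * (1 / (node k)\<^sup>2) + C * (\<sigma> powr (- \<alpha>) * (\<bar>node k\<bar> powr \<alpha> / (node k)\<^sup>2)))"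
      by (rule sum_norm_le) (rule summand)
    also have "\<dots> = C * (\<Sum>k\<in>I. 1 / (node k)\<^sup>2)
        + C * (\<sigma> powr (- \<alpha>) * (\<Sum>k\<in>I. \<bar>node k\<bar> powr \<alpha> / (node k)\<^sup>2))"
      by (simp only: sum.distrib sum_distrib_left)
    also have "\<dots> \<le> C * (\<Sum>k\<in>I. 1 / (node k)\<^sup>2) + C * (\<sigma> powr (- \<alpha>) * C_const \<alpha>)"
      using sum_node_powr_le[OF \<open>\<alpha> < 1\<close> that] \<open>0 < C\<close> by (intro add_left_mono mult_left_mono) auto
    finally show ?thesis .
  qed
  have "cmod (deriv G 0) \<le> C * 1 + C * (\<sigma> powr (- \<alpha>) * C_const \<alpha>)"
    by (rule LIMSEQ_le[OF lim lim_bound]) (blast intro: partial)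
  moreover have "deriv F 0 = of_real \<sigma> * deriv G 0"
  proof -
    have "(F has_field_derivative deriv F 0) (at (0 / of_real \<sigma>))"
      using holo by (simp add: holomorphic_derivI)
    moreover have "((\<lambda>z. z / of_real \<sigma>) has_field_derivative 1 / of_real \<sigma>) (at 0)"
      using \<open>0 < \<sigma>\<close> by (auto intro!: derivative_eq_intros)
    ultimately have "(G has_field_derivative deriv F 0 * (1 / of_real \<sigma>)) (at 0)"
      unfolding G_def by (rule DERIV_chain2)
    then show ?thesis using \<open>0 < \<sigma>\<close> by (simp add: DERIV_imp_deriv)
  qed
  ultimately have "cmod (deriv F 0) \<le> \<sigma> * (C * 1 + C * (\<sigma> powr (- \<alpha>) * C_const \<alpha>))"
    using \<open>0 < \<sigma>\<close> by (simp add: norm_mult)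
  also have "\<dots> = C * (\<sigma> + C_const \<alpha> * (\<sigma> * \<sigma> powr (- \<alpha>)))"
    by (simp add: algebra_simps)
  also have "\<sigma> * \<sigma> powr (- \<alpha>) = \<sigma> powr (1 - \<alpha>)"
    using \<open>0 < \<sigma>\<close> by (simp add: powr_diff powr_minus divide_inverse)
  finally show ?thesis .
qed

section \<open>The commutator estimate\<close>

text \<open>Bernstein's inequality for the orbit seen through a norming functional. The type \<open>\<sigma>\<close> has
  to be strictly above the local spectral radius, because Cauchy's inequality needs a disc whose
  closure lies in the domain of the local resolvent.\<close>

lemma commutator_bound_above_radius:
  fixes A T :: "'a::complex_banach bounded_op"
  assumes "svep (commutator_op A)" "0 \<le> \<alpha>" "\<alpha> < 1" "0 < C"
    and growth: "\<And>t. norm (op_exp (t *\<^sub>R A) * T * op_exp (- (t *\<^sub>R A))) \<le> C * (1 + abs_pow t \<alpha>)"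
    and \<sigma>: "local_spectral_radius (commutator_op A) T < \<sigma>"
  shows "norm (A * T - T * A) \<le> C * (\<sigma> + C_const \<alpha> * \<sigma> powr (1 - \<alpha>))"
proof -
  have "0 < \<sigma>" using local_spectral_radius_nonneg[of "commutator_op A" T] \<sigma> by linarith
  obtain \<phi> where \<phi>: "contractive_functional \<phi>" "cmod (\<phi> (A * T - T * A)) = norm (A * T - T * A)"
    by (rule complex_norming_functional)
  note bl = contractive_functional_bounded_linear[OF \<phi>(1)]
  define c where "c n = \<phi> ((op_apply (commutator_op A) ^^ n) T)" for n
  obtain B where B: "\<And>n. cmod (c n) \<le> B * \<sigma> ^ n"
    unfolding c_def by (rule orbit_growth_le_local_spectral_radius[OF assms(1) \<phi>(1) \<sigma>]) blast
  define F where "F z = (\<Sum>n. c n / fact n * z ^ n)" for z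
  have major: "cmod (c n / fact n * z ^ n) \<le> B * ((\<sigma> * cmod z) ^ n /\<^sub>R fact n)" for n z
    using mult_right_mono[OF B[of n], of "cmod z ^ n / fact n"]
    by (simp add: norm_mult norm_divide norm_power power_mult_distrib field_simps)
  have major_sums: "(\<lambda>n. B * ((\<sigma> * cmod z) ^ n /\<^sub>R fact n)) sums (B * exp (\<sigma> * cmod z))" for z
    by (intro sums_mult exp_converges)
  have sums: "(\<lambda>n. c n / fact n * z ^ n) sums F z" for z
    unfolding F_def using major[of _ z] sums_summable[OF major_sums[of z]]
    by (blast intro: summable_sums summable_comparison_test')
  have holo: "F holomorphic_on ball 0 r" for r
    by (rule power_series_holomorphic[where a = "\<lambda>n. c n / fact n"]) (use sums in simp)
  have "F holomorphic_on UNIV"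
  proof -
    have "F field_differentiable at z" for z
      by (rule holomorphic_on_imp_differentiable_at[OF holo[of "cmod z + 1"]]) auto
    then show ?thesis by (auto simp: holomorphic_on_def intro: field_differentiable_at_within)
  qed
  moreover have "cmod (F z) \<le> B * exp (\<sigma> * cmod z)" for z
    unfolding F_def using norm_suminf_le[OF major[of _ z] sums_summable[OF major_sums]]
      sums_unique[OF major_sums[of z]] by simp
  moreover have "cmod (F (of_real t)) \<le> C * (1 + abs_pow t \<alpha>)" for t
  proof -
    have "\<phi> (t ^ n *\<^sub>R (op_apply (commutator_op A) ^^ n) T /\<^sub>R fact n) = c n / fact n * of_real t ^ n" for n
      by (simp add: c_def linear_scale[OF bounded_linear.linear[OF bl]] scaleR_conv_of_real field_simps)
    with bounded_linear.sums[OF bl conjugation_sums[of t A T]] sums[of "of_real t"]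
    have "F (of_real t) = \<phi> (op_exp (t *\<^sub>R A) * T * op_exp (- (t *\<^sub>R A)))"
      by (simp add: sums_unique2)
    then have "cmod (F (of_real t)) \<le> norm (op_exp (t *\<^sub>R A) * T * op_exp (- (t *\<^sub>R A)))"
      using \<phi>(1) by (simp add: contractive_functional_def)
    then show ?thesis using growth[of t] by linarith
  qed
  ultimately have "cmod (deriv F 0) \<le> C * (\<sigma> + C_const \<alpha> * \<sigma> powr (1 - \<alpha>))"
    using \<open>0 < \<sigma>\<close> assms(2-4) by (intro bernstein_inequality_growth)
  moreover have "deriv F 0 = \<phi> (A * T - T * A)"
  proof -
    have "F has_fps_expansion Abs_fps (\<lambda>n. c n / fact n)"
      by (rule has_fps_expansionI) (use sums in simp)
    from fps_nth_fps_expansion[OF this, of 1] show ?thesis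
      by (simp add: c_def commutator_op_apply)
  qed
  ultimately show ?thesis using \<phi>(2) by simp
qed

text \<open>The bound is continuous in \<open>\<sigma>\<close> from the right, also when the local spectral radius is \<open>0\<close>,
  because the exponent \<open>1 - \<alpha>\<close> is positive.\<close>

theorem corollary4p3:
  fixes A T :: "'a::complex_banach bounded_op" and \<alpha> C\<^sub>T :: real
  assumes "svep (commutator_op A)"
    and "0 \<le> \<alpha>" and "\<alpha> < 1"
    and "C\<^sub>T > 0"
    and "\<And>t :: real. norm (op_exp (t *\<^sub>R A) * T * op_exp (- (t *\<^sub>R A))) \<le> C\<^sub>T * (1 + abs_pow t \<alpha>)"
  shows "norm (A * T - T * A) \<le>
    C\<^sub>T * (local_spectral_radius (commutator_op A) T +
      C_const \<alpha> * local_spectral_radius (commutator_op A) T powr (1 - \<alpha>))"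
proof (rule tendsto_lowerbound)
  let ?r = "local_spectral_radius (commutator_op A) T"
  let ?b = "\<lambda>\<sigma>. C\<^sub>T * (\<sigma> + C_const \<alpha> * \<sigma> powr (1 - \<alpha>))"
  have pow: "((\<lambda>\<sigma>. \<sigma> powr (1 - \<alpha>)) \<longlongrightarrow> ?r powr (1 - \<alpha>)) (at_right ?r)"
  proof (rule tendsto_powr')
    show "?r \<noteq> 0 \<or> 0 < 1 - \<alpha> \<and> (\<forall>\<^sub>F \<sigma> in at_right ?r. 0 \<le> \<sigma>)"
      using \<open>\<alpha> < 1\<close> local_spectral_radius_nonneg[of "commutator_op A" T]
      by (auto simp: eventually_at_right_field intro!: exI[of _ "?r + 1"])
  qed (auto intro: tendsto_intros)
  show "(?b \<longlongrightarrow> ?b ?r) (at_right ?r)"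
    by (intro tendsto_mult tendsto_add tendsto_const tendsto_ident_at pow)
  show "\<forall>\<^sub>F \<sigma> in at_right ?r. norm (A * T - T * A) \<le> ?b \<sigma>"
    using commutator_bound_above_radius[OF assms]
    by (auto simp: eventually_at_right_field intro!: exI[of _ "?r + 1"])
qed simp

end
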